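(* Consider the multi-area interchange scheduling setting described in the context, and assume: (i) for every area $n$, every $q$ with $q\le Q$ and every realization $d_n$ of the net load, the second-stage problem $P_n(q_n,d_n)$ is feasible and is neither primal nor dual degenerate, and $\bar C(q)$ is finite for all $q\le Q$; (ii) for each area $n$, the net loads $\{d_n^t\}_{t\ge1}$ are independent and identically distributed with common distribution $\mathscr{F}_n$; (iii) every one-dimensional minimization in the update rule below has a minimizer (if there are several, any one is chosen). Let $q^0\in\mathbb{R}^I$ with $q^0\le Q$, and generate $\{q^t\}_{t\ge0}$ by asynchronous interface-by-interface scheduling: at time $t=1,2,\dots$, let $i_t=((t-1)\bmod I)+1$, set $q^t(j)=q^{t-1}(j)$ for $j\ne i_t$, and $$q^t(i_t)\in\arg\min_{x\le Q(i_t)}\sum_{n=1}^N\mathbb{E}_{d_n^t}\Big[C_n\big(g_n^*(\,(x,q^{t-1}(-i_t))_n\,,d_n^t)\big)\Big],$$ where $(x,q^{t-1}(-i_t))$ denotes the vector $q^{t-1}$ with its $i_t$-th entry replaced by $x$, and $(\cdot)_n$ denotes its restriction to area $n$ as defined in the context. Then every limit point $\tilde q$ of $\{q^t\}_{t\ge0}$ is an optimal solution of the first-stage problem $\min_{q\le Q}\bar C(q)$.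
   Context: There are $N$ independently operated areas and $I$ scheduling interfaces. Each interface $i\in\{1,\dots,I\}$ connects two distinct areas and carries a scalar flow $q(i)$ in a predetermined direction (from its origin area to its destination area); $q=(q(1),\dots,q(I))\in\mathbb{R}^I$ is the interchange vector and $Q\in\mathbb{R}^I$ the vector of interface capacities; $q\le Q$ is componentwise; $q(-i)$ denotes $q$ with its $i$-th entry removed. For area $n$, $q_n$ is the vector of flows on the interfaces incident to area $n$, taken in the outbound direction: its entry for interface $i$ equals $q(i)$ if $n$ is the origin of interface $i$ and $-q(i)$ if $n$ is its destination. Area $n$ has a generation vector $g_n$, a random net load vector $d_n$ with distribution $\mathscr{F}_n$, a cost $C_n(g_n)=\tfrac12 g_n^\intercal H_n g_n+l_n^\intercal g_n$ with $H_n$ positive definite, a polyhedral set of generation constraints $\mathscr{G}_n$, a matrix $A_n$ of shift factors of internal buses to lines, a matrix $B_n$ of shift factors of the proxy buses to lines, and a vector $F_n$ of line capacities. The second-stage problem $P_n(q_n,d_n)$ is $$\min_{g_n\in\mathscr{G}_n} C_n(g_n)\ \text{ s.t. }\ \mathbf 1^\intercal(d_n-g_n)+\mathbf 1^\intercal q_n=0,\quad A_n(d_n-g_n)+B_nq_n\le F_n,$$ with optimal solution $g_n^*(q_n,d_n)$. The expected overall cost is $\bar C(q)=\sum_{n=1}^N\mathbb{E}_{d_n\sim\mathscr{F}_n}\big[C_n(g_n^*(q_n,d_n))\big]$, and the first-stage problem is $\min_{q\le Q}\bar C(q)$. *)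

theory Defs
  imports "HOL-Probability.Probability"
begin

text \<open>Data of one area n. Internal buses are indexed by k < nbus, lines by m < nline,
  the rows of the polyhedral generation constraint set by r < ncon.
  Vectors are functions nat => real; only the entries in the index range matter.
  Interfaces are indexed by 1..I; the columns of Bm are indexed by interface numbers
  (only columns of interfaces incident to the area are ever used).\<close>

record area_data =
  nbus  :: nat
  nline :: nat
  ncon  :: nat
  Hm    :: "nat \<Rightarrow> nat \<Rightarrow> real"
  lv    :: "nat \<Rightarrow> real"
  Gc    :: "nat \<Rightarrow> nat \<Rightarrow> real"   \<comment> \<open>G_n = {g. Gc g <= gb}\<close>
  gb    :: "nat \<Rightarrow> real"
  Am    :: "nat \<Rightarrow> nat \<Rightarrow> real"   \<comment> \<open>A_n (line m, bus k)\<close>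
  Bm    :: "nat \<Rightarrow> nat \<Rightarrow> real"   \<comment> \<open>B_n (line m, interface i)\<close>
  Fv    :: "nat \<Rightarrow> real"

text \<open>q_n: flows on interfaces incident to area n in outbound direction
  (zero on non-incident interfaces).\<close>
definition qloc :: "nat \<Rightarrow> (nat \<Rightarrow> nat) \<Rightarrow> (nat \<Rightarrow> nat) \<Rightarrow> (nat \<Rightarrow> real) \<Rightarrow> nat \<Rightarrow> (nat \<Rightarrow> real)" where
  "qloc I orig dest q n = (\<lambda>i. if i \<in> {1..I} \<and> orig i = n then q i
                               else if i \<in> {1..I} \<and> dest i = n then - q i else 0)"

definition gcost :: "area_data \<Rightarrow> (nat \<Rightarrow> real) \<Rightarrow> real" where
  "gcost a g = (1/2) * (\<Sum>j<nbus a. \<Sum>k<nbus a. g j * Hm a j k * g k) + (\<Sum>k<nbus a. lv a k * g k)"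

definition feas :: "area_data \<Rightarrow> nat \<Rightarrow> (nat \<Rightarrow> real) \<Rightarrow> (nat \<Rightarrow> real) \<Rightarrow> (nat \<Rightarrow> real) set" where
  "feas a I qn d = {g. (\<forall>k. nbus a \<le> k \<longrightarrow> g k = 0)
      \<and> (\<forall>r<ncon a. (\<Sum>k<nbus a. Gc a r k * g k) \<le> gb a r)
      \<and> (\<Sum>k<nbus a. d k - g k) + (\<Sum>i\<in>{1..I}. qn i) = 0
      \<and> (\<forall>m<nline a. (\<Sum>k<nbus a. Am a m k * (d k - g k)) + (\<Sum>i\<in>{1..I}. Bm a m i * qn i) \<le> Fv a m)}"

definition is_opt :: "area_data \<Rightarrow> nat \<Rightarrow> (nat \<Rightarrow> real) \<Rightarrow> (nat \<Rightarrow> real) \<Rightarrow> (nat \<Rightarrow> real) \<Rightarrow> bool" where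
  "is_opt a I qn d g \<longleftrightarrow> g \<in> feas a I qn d \<and> (\<forall>g'\<in>feas a I qn d. gcost a g \<le> gcost a g')"

definition gstar :: "area_data \<Rightarrow> nat \<Rightarrow> (nat \<Rightarrow> real) \<Rightarrow> (nat \<Rightarrow> real) \<Rightarrow> (nat \<Rightarrow> real)" where
  "gstar a I qn d = (THE g. is_opt a I qn d g)"

definition act_con :: "area_data \<Rightarrow> (nat \<Rightarrow> real) \<Rightarrow> nat set" where
  "act_con a g = {r. r < ncon a \<and> (\<Sum>k<nbus a. Gc a r k * g k) = gb a r}"

definition act_line :: "area_data \<Rightarrow> nat \<Rightarrow> (nat \<Rightarrow> real) \<Rightarrow> (nat \<Rightarrow> real) \<Rightarrow> (nat \<Rightarrow> real) \<Rightarrow> nat set" where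
  "act_line a I qn d g = {m. m < nline a \<and>
     (\<Sum>k<nbus a. Am a m k * (d k - g k)) + (\<Sum>i\<in>{1..I}. Bm a m i * qn i) = Fv a m}"

text \<open>Primal nondegeneracy (LICQ): the gradients (w.r.t. g) of the equality constraint
  and of all active inequality constraints are linearly independent.\<close>
definition primal_nondeg :: "area_data \<Rightarrow> nat \<Rightarrow> (nat \<Rightarrow> real) \<Rightarrow> (nat \<Rightarrow> real) \<Rightarrow> (nat \<Rightarrow> real) \<Rightarrow> bool" where
  "primal_nondeg a I qn d g \<longleftrightarrow>
     (\<forall>(c0::real) (cr::nat\<Rightarrow>real) (cm::nat\<Rightarrow>real).
        (\<forall>k<nbus a. c0 + (\<Sum>r\<in>act_con a g. cr r * Gc a r k)
                      - (\<Sum>m\<in>act_line a I qn d g. cm m * Am a m k) = 0)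
        \<longrightarrow> c0 = 0 \<and> (\<forall>r\<in>act_con a g. cr r = 0) \<and> (\<forall>m\<in>act_line a I qn d g. cm m = 0))"

text \<open>Dual nondegeneracy (strict complementarity): there are KKT multipliers at g for which
  every active inequality constraint has a strictly positive multiplier.
  Inequalities in <= form with gradients Gc r (polyhedral rows) and -Am m (line rows);
  equality constraint with gradient (1,...,1).\<close>
definition dual_nondeg :: "area_data \<Rightarrow> nat \<Rightarrow> (nat \<Rightarrow> real) \<Rightarrow> (nat \<Rightarrow> real) \<Rightarrow> (nat \<Rightarrow> real) \<Rightarrow> bool" where
  "dual_nondeg a I qn d g \<longleftrightarrow>
     (\<exists>(nu::real) (lr::nat\<Rightarrow>real) (lm::nat\<Rightarrow>real).
        (\<forall>k<nbus a. (\<Sum>j<nbus a. Hm a k j * g j) + lv a k + nu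
                    + (\<Sum>r\<in>act_con a g. lr r * Gc a r k)
                    - (\<Sum>m\<in>act_line a I qn d g. lm m * Am a m k) = 0)
        \<and> (\<forall>r\<in>act_con a g. lr r > 0) \<and> (\<forall>m\<in>act_line a I qn d g. lm m > 0))"

definition nondegenerate :: "area_data \<Rightarrow> nat \<Rightarrow> (nat \<Rightarrow> real) \<Rightarrow> (nat \<Rightarrow> real) \<Rightarrow> bool" where
  "nondegenerate a I qn d \<longleftrightarrow>
     (\<exists>g. is_opt a I qn d g \<and> primal_nondeg a I qn d g \<and> dual_nondeg a I qn d g)"

definition Cbar :: "nat \<Rightarrow> nat \<Rightarrow> (nat \<Rightarrow> nat) \<Rightarrow> (nat \<Rightarrow> nat) \<Rightarrow> (nat \<Rightarrow> area_data)
                     \<Rightarrow> (nat \<Rightarrow> (nat \<Rightarrow> real) measure) \<Rightarrow> (nat \<Rightarrow> real) \<Rightarrow> real" where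
  "Cbar N I orig dest ar F q =
     (\<Sum>n\<in>{1..N}. integral\<^sup>L (F n) (\<lambda>d. gcost (ar n) (gstar (ar n) I (qloc I orig dest q n) d)))"

end

theory Submission
  imports Defs
begin

text \<open>For a fixed load, the KKT multipliers give a subgradient of the second-stage value function, and
  primal nondegeneracy makes it a derivative. Hence the convex function \<open>Cbar\<close> is minimal at a point
  as soon as it is minimal there in each coordinate separately.

  Since generation balances net exports and the costs are coercive, each coordinate step is bounded on
  sublevel sets. So from a limit point one can pass, along subsequences, to limits of the successive
  iterates; all of them have the same value. Each limit is minimal in the next coordinate to be updated,
  and joint minimality over a coordinate subspace is inherited by points of that subspace with
  equal value. Going around a full cycle, the limit point is minimal in every coordinate.\<close>

subsection \<open>Second-stage value function\<close>

text \<open>A convex function with kinks can be minimal in every coordinate without being minimal,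
  so smoothness has to be used. It is not established for \<open>Cbar\<close> itself: nondegeneracy
  holds off a null set that may depend on \<open>q\<close>, so for a common load only countably many
  interchange vectors can be compared. Therefore difference quotients along the dyadic steps
  \<open>(1/2) ^ m\<close> are taken under the expectation, with convexity supplying the integrable
  bound for the passage to the limit.

  The descent argument does not appeal to uniqueness of coordinate minimizers, so the limit of the
  successors may a priori differ from the limit point. Only equality of their values is used.
  Carrying minimality over to limits requires continuity of \<open>Cbar\<close> up to the caps,
  where convexity alone yields just one of the two inequalities.\<close>

lemma linear_system_solvable:
  fixes A :: "'s \<Rightarrow> nat \<Rightarrow> real"
  assumes "finite S"
    and "\<forall>c. (\<forall>k<n. (\<Sum>s\<in>S. c s * A s k) = 0) \<longrightarrow> (\<forall>s\<in>S. c s = 0)"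
  shows "\<exists>u. \<forall>s\<in>S. (\<Sum>k<n. A s k * u k) = b s"
  using assms
proof (induction S arbitrary: b rule: finite_induct)
  case empty
  then show ?case by simp
next
  case (insert s S)
  have indep: "\<forall>c. (\<forall>k<n. (\<Sum>s\<in>S. c s * A s k) = 0) \<longrightarrow> (\<forall>s\<in>S. c s = 0)"
  proof (intro allI impI)
    fix c assume c: "\<forall>k<n. (\<Sum>s\<in>S. c s * A s k) = 0"
    have "(\<Sum>t\<in>insert s S. (c(s:=0)) t * A t k) = (\<Sum>t\<in>S. c t * A t k)" for k
      using insert.hyps by (auto intro!: sum.cong)
    then have "\<forall>t\<in>insert s S. (c(s:=0)) t = 0"
      using c insert.prems[THEN spec, of "c(s:=0)"] by presburger
    with insert.hyps show "\<forall>s\<in>S. c s = 0" by (metis fun_upd_other insertI2)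
  qed
  note IH = insert.IH[OF indep]
  \<comment> \<open>The induction hypothesis holds for every right-hand side; unit right-hand sides
    give vectors \<open>U t\<close> dual to the rows in \<open>S\<close>.\<close>
  have "\<forall>t. \<exists>u. \<forall>s\<in>S. (\<Sum>k<n. A s k * u k) = (if s = t then 1 else 0)"
    by (intro allI IH)
  then obtain U where U: "\<And>t s. s \<in> S \<Longrightarrow> (\<Sum>k<n. A s k * U t k) = (if s = t then 1 else 0)"
    by metis
  \<comment> \<open>Some vector is orthogonal to the rows in \<open>S\<close> but not to row
    \<open>s\<close>; otherwise \<open>c\<close> below is a nontrivial vanishing combination of the
    rows.\<close>
  have "\<exists>z. (\<forall>t\<in>S. (\<Sum>k<n. A t k * z k) = 0) \<and> (\<Sum>k<n. A s k * z k) \<noteq> 0"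
  proof (rule ccontr)
    assume no: "\<not> ?thesis"
    define c where "c t = (if t = s then 1 else - (\<Sum>k<n. A s k * U t k))" for t
    have "(\<Sum>t\<in>insert s S. c t * A t k) = 0" if k: "k < n" for k
    proof -
      \<comment> \<open>The unit vector \<open>k\<close> with its components along the dual vectors
        removed, hence orthogonal to the rows in \<open>S\<close>. Orthogonality to row
        \<open>s\<close> then expresses entry \<open>k\<close> of that row through the other rows,
        with coefficients independent of \<open>k\<close>.\<close>
      define z where "z l = (if l = k then 1 else 0) - (\<Sum>t\<in>S. A t k * U t l)" for l
      have dot: "(\<Sum>l<n. A r l * z l) = A r k - (\<Sum>t\<in>S. A t k * (\<Sum>l<n. A r l * U t l))" for r
      proof -
        have "(\<Sum>l<n. A r l * z l)
            = (\<Sum>l<n. A r l * (if l = k then 1 else 0)) - (\<Sum>l<n. \<Sum>t\<in>S. A r l * (A t k * U t l))"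
          by (simp add: z_def right_diff_distrib sum_subtractf sum_distrib_left)
        also have "(\<Sum>l<n. A r l * (if l = k then 1 else 0)) = A r k"
          using k by (simp add: if_distrib cong: if_cong)
        also have "(\<Sum>l<n. \<Sum>t\<in>S. A r l * (A t k * U t l)) = (\<Sum>t\<in>S. A t k * (\<Sum>l<n. A r l * U t l))"
          by (subst sum.swap) (simp add: sum_distrib_left mult_ac)
        finally show ?thesis .
      qed
      have "(\<Sum>l<n. A r l * z l) = 0" if r: "r \<in> S" for r
      proof -
        have "(\<Sum>t\<in>S. A t k * (\<Sum>l<n. A r l * U t l)) = (\<Sum>t\<in>S. if r = t then A t k else 0)"
          by (rule sum.cong) (simp_all add: U[OF r])
        also have "\<dots> = A r k" using insert.hyps r by simp
        finally show ?thesis by (simp add: dot)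
      qed
      with no have "(\<Sum>l<n. A s l * z l) = 0" by blast
      with dot have "A s k = (\<Sum>t\<in>S. A t k * (\<Sum>l<n. A s l * U t l))" by simp
      moreover have "(\<Sum>t\<in>S. c t * A t k) = - (\<Sum>t\<in>S. A t k * (\<Sum>l<n. A s l * U t l))"
        unfolding sum_negf[symmetric] using insert.hyps
        by (intro sum.cong) (auto simp: c_def)
      ultimately show ?thesis using insert.hyps by (simp add: c_def)
    qed
    with insert.prems have "c s = 0" by blast
    then show False by (simp add: c_def)
  qed
  then obtain z where z: "\<And>t. t \<in> S \<Longrightarrow> (\<Sum>k<n. A t k * z k) = 0"
    and zs: "(\<Sum>k<n. A s k * z k) \<noteq> 0" by blast
  obtain u where u: "\<And>t. t \<in> S \<Longrightarrow> (\<Sum>k<n. A t k * u k) = b t" using IH by blast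
  define \<alpha> where "\<alpha> = (b s - (\<Sum>k<n. A s k * u k)) / (\<Sum>k<n. A s k * z k)"
  have "(\<Sum>k<n. A t k * (u k + \<alpha> * z k)) = (\<Sum>k<n. A t k * u k) + \<alpha> * (\<Sum>k<n. A t k * z k)" for t
    by (simp add: algebra_simps sum.distrib sum_distrib_left)
  then have "\<forall>t\<in>insert s S. (\<Sum>k<n. A t k * (u k + \<alpha> * z k)) = b t"
    using u z zs by (auto simp: \<alpha>_def)
  then show ?case by (intro exI[of _ "\<lambda>k. u k + \<alpha> * z k"])
qed

section \<open>The quadratic generation cost and uniqueness of the optimal generation\<close>

definition cost_grad :: "area_data \<Rightarrow> (nat \<Rightarrow> real) \<Rightarrow> nat \<Rightarrow> real" where
  "cost_grad a g k = (\<Sum>j<nbus a. Hm a k j * g j) + lv a k"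

definition quad_form :: "area_data \<Rightarrow> (nat \<Rightarrow> real) \<Rightarrow> real" where
  "quad_form a v = (\<Sum>j<nbus a. \<Sum>k<nbus a. v j * Hm a j k * v k)"

text \<open>Symmetry belongs to the notion: it is what makes \<open>cost_grad\<close> the gradient
  of \<open>gcost\<close>.\<close>

definition posdef :: "area_data \<Rightarrow> bool" where
  "posdef a \<longleftrightarrow> (\<forall>j<nbus a. \<forall>k<nbus a. Hm a j k = Hm a k j)
     \<and> (\<forall>v. (\<exists>k<nbus a. v k \<noteq> 0) \<longrightarrow> quad_form a v > 0)"

lemma quad_form_nonneg:
  assumes "posdef a" shows "quad_form a v \<ge> 0"
proof (cases "\<exists>k<nbus a. v k \<noteq> 0")
  case True then show ?thesis using assms by (auto simp: posdef_def intro: less_imp_le)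
next
  case False then show ?thesis by (simp add: quad_form_def)
qed

lemma quad_form_scale: "quad_form a (\<lambda>k. t * v k) = t\<^sup>2 * quad_form a v"
  by (simp add: quad_form_def sum_distrib_left power2_eq_square mult_ac)

text \<open>The cost is quadratic, so its second-order expansion is exact; symmetry merges the two
  cross terms.\<close>

lemma gcost_add:
  assumes "posdef a"
  shows "gcost a (\<lambda>k. g k + x k) = gcost a g + (\<Sum>k<nbus a. cost_grad a g k * x k) + quad_form a x / 2"
proof -
  have sym: "Hm a j k = Hm a k j" if "j < nbus a" "k < nbus a" for j k
    using assms that by (auto simp: posdef_def)
  have "(\<Sum>j<nbus a. \<Sum>k<nbus a. g j * Hm a j k * x k) = (\<Sum>k<nbus a. \<Sum>j<nbus a. x k * Hm a k j * g j)"
    by (subst sum.swap) (auto intro!: sum.cong simp: sym)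
  then have cross: "(\<Sum>j<nbus a. \<Sum>k<nbus a. g j * Hm a j k * x k) = (\<Sum>j<nbus a. \<Sum>k<nbus a. x j * Hm a j k * g k)" .
  have "(\<Sum>j<nbus a. \<Sum>k<nbus a. (g j + x j) * Hm a j k * (g k + x k))
     = (\<Sum>j<nbus a. \<Sum>k<nbus a. g j * Hm a j k * g k) + (\<Sum>j<nbus a. \<Sum>k<nbus a. g j * Hm a j k * x k)
      + (\<Sum>j<nbus a. \<Sum>k<nbus a. x j * Hm a j k * g k) + quad_form a x"
    by (simp add: quad_form_def algebra_simps sum.distrib)
  moreover have "(\<Sum>k<nbus a. cost_grad a g k * x k)
      = (\<Sum>j<nbus a. \<Sum>k<nbus a. x j * Hm a j k * g k) + (\<Sum>k<nbus a. lv a k * x k)"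
    by (simp add: cost_grad_def algebra_simps sum.distrib sum_distrib_left sum_distrib_right)
  ultimately show ?thesis
    using cross by (simp add: gcost_def algebra_simps sum.distrib)
qed

lemma gcost_subgradient:
  assumes "posdef a"
  shows "gcost a g + (\<Sum>k<nbus a. cost_grad a g k * (g' k - g k)) \<le> gcost a g'"
  using gcost_add[OF assms, of g "\<lambda>k. g' k - g k"] quad_form_nonneg[OF assms, of "\<lambda>k. g' k - g k"]
  by simp

lemma gcost_convex:
  assumes "posdef a" "0 \<le> t" "t \<le> 1"
  shows "gcost a (\<lambda>k. (1 - t) * g k + t * g' k) \<le> (1 - t) * gcost a g + t * gcost a g'"
proof -
  define x where "x k = g' k - g k" for k
  have e: "(\<lambda>k. (1 - t) * g k + t * g' k) = (\<lambda>k. g k + t * x k)" "g' = (\<lambda>k. g k + x k)"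
    by (auto simp: x_def algebra_simps)
  have "(\<Sum>k<nbus a. cost_grad a g k * (t * x k)) = t * (\<Sum>k<nbus a. cost_grad a g k * x k)"
    by (simp add: sum_distrib_left mult_ac)
  moreover have "t\<^sup>2 * quad_form a x \<le> t * quad_form a x"
    using assms quad_form_nonneg[OF assms(1), of x]
    by (intro mult_right_mono) (auto simp: power2_eq_square mult_left_le)
  ultimately show ?thesis
    unfolding e by (simp add: gcost_add[OF assms(1)] quad_form_scale algebra_simps)
qed

text \<open>All constraints are affine in \<open>g\<close> and \<open>qn\<close> jointly, so the
  interchange vectors may be mixed along with the generation. This is the source of convexity in the
  interchange.\<close>

lemma feas_convex:
  assumes "g \<in> feas a I qn d" "g' \<in> feas a I qn' d" "0 \<le> t" "t \<le> 1"
  shows "(\<lambda>k. (1 - t) * g k + t * g' k) \<in> feas a I (\<lambda>i. (1 - t) * qn i + t * qn' i) d"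
proof -
  have con: "(\<Sum>k<nbus a. Gc a r k * ((1 - t) * g k + t * g' k))
      = (1 - t) * (\<Sum>k<nbus a. Gc a r k * g k) + t * (\<Sum>k<nbus a. Gc a r k * g' k)" for r
    by (simp add: sum_distrib_left sum.distrib algebra_simps sum_subtractf)
  have bal: "(\<Sum>k<nbus a. d k - ((1 - t) * g k + t * g' k)) + (\<Sum>i\<in>{1..I}. (1 - t) * qn i + t * qn' i)
      = (1 - t) * ((\<Sum>k<nbus a. d k - g k) + (\<Sum>i\<in>{1..I}. qn i)) + t * ((\<Sum>k<nbus a. d k - g' k) + (\<Sum>i\<in>{1..I}. qn' i))"
    by (simp add: sum_distrib_left sum.distrib algebra_simps sum_subtractf)
  have line: "(\<Sum>k<nbus a. Am a m k * (d k - ((1 - t) * g k + t * g' k))) + (\<Sum>i\<in>{1..I}. Bm a m i * ((1 - t) * qn i + t * qn' i))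
      = (1 - t) * ((\<Sum>k<nbus a. Am a m k * (d k - g k)) + (\<Sum>i\<in>{1..I}. Bm a m i * qn i))
      + t * ((\<Sum>k<nbus a. Am a m k * (d k - g' k)) + (\<Sum>i\<in>{1..I}. Bm a m i * qn' i))" for m
    by (simp add: sum_distrib_left sum.distrib algebra_simps sum_subtractf)
  have cc: "(1 - t) * u + t * v \<le> w" if "u \<le> w" "v \<le> w" for u v w :: real
    using convex_bound_le[of u w v "1 - t" t] that assms by simp
  show ?thesis
    using assms unfolding feas_def mem_Collect_eq con bal line by (auto intro!: cc)
qed

text \<open>The midpoint of two distinct optima would be feasible and cheaper by an eighth of the
  quadratic form of their difference. Entries beyond \<open>nbus a\<close> cannot differ, because
  \<open>feas\<close> sets them to zero.\<close>

lemma is_opt_unique: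
  assumes pd: "posdef a" and g: "is_opt a I qn d g" and g': "is_opt a I qn d g'"
  shows "g = g'"
proof (rule ccontr)
  assume ne: "g \<noteq> g'"
  define x where "x k = g' k - g k" for k
  have out: "\<forall>k\<ge>nbus a. g k = g' k" using g g' by (auto simp: is_opt_def feas_def)
  with ne have "\<exists>k<nbus a. x k \<noteq> 0" unfolding x_def
    by (metis eq_iff_diff_eq_0 ext linorder_not_less)
  with pd have pos: "quad_form a x > 0" by (auto simp: posdef_def)
  have e: "g' = (\<lambda>k. g k + x k)" "(\<lambda>k. (1 - 1/2) * g k + 1/2 * g' k) = (\<lambda>k. g k + 1/2 * x k)"
    by (simp_all add: x_def fun_eq_iff field_simps)
  have "gcost a g' = gcost a g" using g g' by (auto simp: is_opt_def intro: antisym)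
  then have "(\<Sum>k<nbus a. cost_grad a g k * x k) = - quad_form a x / 2"
    unfolding e(1) gcost_add[OF pd] by simp
  then have "gcost a (\<lambda>k. g k + 1/2 * x k) = gcost a g - quad_form a x / 8"
    using gcost_add[OF pd, of g "\<lambda>k. 1/2 * x k"] quad_form_scale[of a "1/2" x]
    by (simp add: sum_divide_distrib[symmetric] power2_eq_square)
  moreover have "(\<lambda>k. g k + 1/2 * x k) \<in> feas a I qn d"
    using feas_convex[of g a I qn d g' qn "1/2"] g g' unfolding e(2)
    by (simp add: is_opt_def)
  ultimately show False using g pos by (auto simp: is_opt_def)
qed

lemma gstar_eq:
  assumes "posdef a" "is_opt a I qn d g" shows "gstar a I qn d = g"
  unfolding gstar_def using assms is_opt_unique by (intro the_equality) auto

text \<open>Positive definiteness makes \<open>Hm\<close> invertible, so at some \<open>y\<close>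
  every entry of the gradient equals \<open>\<tau>\<close>; the supporting hyperplane at
  \<open>y\<close> then sees only the total generation.\<close>

lemma gcost_linear_lower_bound:
  assumes pd: "posdef a"
  shows "\<exists>c. \<forall>g. \<tau> * (\<Sum>k<nbus a. g k) - c \<le> gcost a g"
proof -
  have "\<exists>y. \<forall>s\<in>{..<nbus a}. (\<Sum>k<nbus a. Hm a s k * y k) = \<tau> - lv a s"
  proof (rule linear_system_solvable, simp, intro allI impI)
    fix c assume c: "\<forall>k<nbus a. (\<Sum>s<nbus a. c s * Hm a s k) = 0"
    have "quad_form a c = (\<Sum>k<nbus a. (\<Sum>s<nbus a. c s * Hm a s k) * c k)"
      unfolding quad_form_def by (subst sum.swap) (simp add: sum_distrib_right)
    also have "\<dots> = 0" using c by simp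
    finally show "\<forall>s\<in>{..<nbus a}. c s = 0" using pd unfolding posdef_def
      by (metis lessThan_iff less_irrefl)
  qed
  then obtain y where y: "\<And>s. s < nbus a \<Longrightarrow> (\<Sum>k<nbus a. Hm a s k * y k) = \<tau> - lv a s" by auto
  have "(\<Sum>k<nbus a. cost_grad a y k * (g k - y k)) = \<tau> * (\<Sum>k<nbus a. g k) - \<tau> * (\<Sum>k<nbus a. y k)" for g
    by (simp add: cost_grad_def y sum_distrib_left sum_subtractf[symmetric] right_diff_distrib)
  then have "\<tau> * (\<Sum>k<nbus a. g k) - (\<tau> * (\<Sum>k<nbus a. y k) - gcost a y) \<le> gcost a g" for g
    using gcost_subgradient[OF pd, of y g] by simp
  then show ?thesis by blast
qed

text \<open>The slopes 1 and -1 together control the absolute value of the total generation, which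
  power balance ties to the net export.\<close>

lemma gcost_coercive:
  assumes pd: "posdef a"
  shows "\<exists>c\<ge>0. \<forall>g. \<bar>\<Sum>k<nbus a. g k\<bar> - c \<le> gcost a g"
proof -
  obtain c1 c2 where "\<forall>g. 1 * (\<Sum>k<nbus a. g k) - c1 \<le> gcost a g"
    "\<forall>g. (-1) * (\<Sum>k<nbus a. g k) - c2 \<le> gcost a g"
    using gcost_linear_lower_bound[OF pd] by metis
  then have "\<bar>\<Sum>k<nbus a. g k\<bar> - max 0 (max c1 c2) \<le> gcost a g" for g
    by (smt (verit) max_def)
  then show ?thesis by (intro exI[of _ "max 0 (max c1 c2)"]) auto
qed

text \<open>The KKT multipliers form a subgradient of the value function at \<open>qn\<close>; linear independence of
  the active rows gives a feasible direction that keeps them active, so along every ray the same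
  linear functional bounds the value function from above to first order.\<close>

lemma nondegenerate_first_order:
  assumes pd: "posdef a" and nd: "nondegenerate a I qn d"
  shows "\<exists>lam. (\<forall>qn' g'. g' \<in> feas a I qn' d \<longrightarrow>
             gcost a (gstar a I qn d) + (\<Sum>i\<in>{1..I}. lam i * (qn' i - qn i)) \<le> gcost a g')
       \<and> (\<forall>r. \<exists>K. \<forall>\<^sub>F h in at_right 0. \<exists>g'\<in>feas a I (\<lambda>i. qn i + h * r i) d.
             gcost a g' \<le> gcost a (gstar a I qn d) + h * (\<Sum>i\<in>{1..I}. lam i * r i) + K * h\<^sup>2)"
proof -
  from nd obtain g where g: "is_opt a I qn d g" "primal_nondeg a I qn d g" "dual_nondeg a I qn d g"
    unfolding nondegenerate_def by blast
  have gs: "gstar a I qn d = g" by (rule gstar_eq[OF pd g(1)])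
  have gf: "g \<in> feas a I qn d" using g(1) by (simp add: is_opt_def)
  let ?C = "act_con a g" and ?L = "act_line a I qn d g"
  have fin: "finite ?C" "finite ?L" by (auto simp: act_con_def act_line_def)
  obtain nu lr lm where
    kkt0: "\<And>k. k < nbus a \<Longrightarrow> (\<Sum>j<nbus a. Hm a k j * g j) + lv a k + nu
              + (\<Sum>r\<in>?C. lr r * Gc a r k) - (\<Sum>m\<in>?L. lm m * Am a m k) = 0"
    and lr: "\<And>r. r \<in> ?C \<Longrightarrow> lr r > 0" and lm: "\<And>m. m \<in> ?L \<Longrightarrow> lm m > 0"
    using g(3) unfolding dual_nondeg_def by blast
  \<comment> \<open>The derivative of the Lagrangian in the interchange: the line multipliers
    weighted by the proxy-bus shift factors, minus the balance multiplier.\<close>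
  define lam where "lam i = (\<Sum>m\<in>?L. lm m * Bm a m i) - nu" for i
  have kkt: "(\<Sum>k<nbus a. cost_grad a g k * x k) = - nu * (\<Sum>k<nbus a. x k)
       - (\<Sum>r\<in>?C. lr r * (\<Sum>k<nbus a. Gc a r k * x k)) + (\<Sum>m\<in>?L. lm m * (\<Sum>k<nbus a. Am a m k * x k))" for x
  proof -
    have cg: "cost_grad a g k = - nu - (\<Sum>r\<in>?C. lr r * Gc a r k) + (\<Sum>m\<in>?L. lm m * Am a m k)" if "k < nbus a" for k
      using kkt0[OF that] by (simp add: cost_grad_def)
    have "(\<Sum>k<nbus a. cost_grad a g k * x k)
       = (\<Sum>k<nbus a. (- nu) * x k - (\<Sum>r\<in>?C. lr r * Gc a r k * x k) + (\<Sum>m\<in>?L. lm m * Am a m k * x k))"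
      by (intro sum.cong refl) (simp add: cg left_diff_distrib distrib_right sum_distrib_right)
    also have "\<dots> = - nu * (\<Sum>k<nbus a. x k) - (\<Sum>k<nbus a. \<Sum>r\<in>?C. lr r * Gc a r k * x k)
        + (\<Sum>k<nbus a. \<Sum>m\<in>?L. lm m * Am a m k * x k)"
      by (simp add: sum.distrib sum_subtractf sum_distrib_left sum_negf)
    also have "(\<Sum>k<nbus a. \<Sum>r\<in>?C. lr r * Gc a r k * x k) = (\<Sum>r\<in>?C. lr r * (\<Sum>k<nbus a. Gc a r k * x k))"
      by (subst sum.swap) (simp add: sum_distrib_left mult_ac)
    also have "(\<Sum>k<nbus a. \<Sum>m\<in>?L. lm m * Am a m k * x k) = (\<Sum>m\<in>?L. lm m * (\<Sum>k<nbus a. Am a m k * x k))"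
      by (subst sum.swap) (simp add: sum_distrib_left mult_ac)
    finally show ?thesis .
  qed
  have lamsum: "(\<Sum>i\<in>{1..I}. lam i * r i)
      = (\<Sum>m\<in>?L. lm m * (\<Sum>i\<in>{1..I}. Bm a m i * r i)) - nu * (\<Sum>i\<in>{1..I}. r i)" for r
  proof -
    have "(\<Sum>m\<in>?L. lm m * (\<Sum>i\<in>{1..I}. Bm a m i * r i)) = (\<Sum>i\<in>{1..I}. \<Sum>m\<in>?L. lm m * Bm a m i * r i)"
      by (subst sum.swap) (simp add: sum_distrib_left mult_ac)
    then show ?thesis
      by (simp add: lam_def left_diff_distrib sum_subtractf sum_distrib_left sum_distrib_right)
  qed
  have lower: "gcost a g + (\<Sum>i\<in>{1..I}. lam i * (qn' i - qn i)) \<le> gcost a g'"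
    if g': "g' \<in> feas a I qn' d" for qn' g'
  proof -
    define x where "x k = g' k - g k" for k
    define p where "p i = qn' i - qn i" for i
    have bal: "(\<Sum>k<nbus a. x k) = (\<Sum>i\<in>{1..I}. p i)"
      using gf g' by (simp add: feas_def x_def p_def sum_subtractf)
    \<comment> \<open>Rows active at \<open>g\<close> hold there with equality, so moving to a
      feasible point can only lower their left-hand sides; the positive multipliers preserve the
      sign.\<close>
    have con: "(\<Sum>k<nbus a. Gc a r k * x k) \<le> 0" if "r \<in> ?C" for r
      using that g' by (auto simp: act_con_def feas_def x_def right_diff_distrib sum_subtractf)
    have line: "(\<Sum>i\<in>{1..I}. Bm a m i * p i) \<le> (\<Sum>k<nbus a. Am a m k * x k)" if "m \<in> ?L" for m
    proof -
      have "(\<Sum>k<nbus a. Am a m k * (d k - g' k)) + (\<Sum>i\<in>{1..I}. Bm a m i * qn' i)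
         \<le> (\<Sum>k<nbus a. Am a m k * (d k - g k)) + (\<Sum>i\<in>{1..I}. Bm a m i * qn i)"
        using that g' by (auto simp: act_line_def feas_def)
      then show ?thesis by (simp add: x_def p_def right_diff_distrib sum_subtractf)
    qed
    have "(\<Sum>r\<in>?C. lr r * (\<Sum>k<nbus a. Gc a r k * x k)) \<le> 0"
      by (rule sum_nonpos, rule mult_nonneg_nonpos) (use con lr in \<open>auto intro: less_imp_le\<close>)
    moreover have "(\<Sum>m\<in>?L. lm m * (\<Sum>i\<in>{1..I}. Bm a m i * p i)) \<le> (\<Sum>m\<in>?L. lm m * (\<Sum>k<nbus a. Am a m k * x k))"
      using line lm by (intro sum_mono mult_left_mono) (auto intro: less_imp_le)
    ultimately have "(\<Sum>i\<in>{1..I}. lam i * p i) \<le> (\<Sum>k<nbus a. cost_grad a g k * x k)"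
      unfolding kkt lamsum bal by simp
    then show ?thesis
      using gcost_subgradient[OF pd, of g g'] by (simp add: x_def p_def)
  qed
  have upper: "\<exists>K. \<forall>\<^sub>F h in at_right 0. \<exists>g'\<in>feas a I (\<lambda>i. qn i + h * r i) d.
             gcost a g' \<le> gcost a g + h * (\<Sum>i\<in>{1..I}. lam i * r i) + K * h\<^sup>2" for r
  proof -
    \<comment> \<open>The balance, the active generation rows and the active line rows are stacked
      into one system whose independence is primal nondegeneracy. Its right-hand side
      \<open>b\<close> prescribes the change of each row that keeps these equalities valid while the
      interchange moves along \<open>r\<close>.\<close>
    define A where "A s k = (case s of Inl _ \<Rightarrow> 1 | Inr (Inl r) \<Rightarrow> Gc a r k | Inr (Inr m) \<Rightarrow> - Am a m k)"
      for s :: "unit + nat + nat" and k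
    define b where "b s = (case s of Inl _ \<Rightarrow> (\<Sum>i\<in>{1..I}. r i) | Inr (Inl r) \<Rightarrow> 0
        | Inr (Inr m) \<Rightarrow> - (\<Sum>i\<in>{1..I}. Bm a m i * r i))" for s :: "unit + nat + nat"
    define S where "S = {()} <+> (?C <+> ?L)"
    have "\<exists>u. \<forall>s\<in>S. (\<Sum>k<nbus a. A s k * u k) = b s"
    proof (rule linear_system_solvable, goal_cases)
      case 1 show ?case using fin by (simp add: S_def)
    next
      case 2
      show ?case
      proof (intro allI impI)
        fix c assume c: "\<forall>k<nbus a. (\<Sum>s\<in>S. c s * A s k) = 0"
        have "(\<Sum>s\<in>S. c s * A s k) = c (Inl ()) + (\<Sum>r\<in>?C. c (Inr (Inl r)) * Gc a r k)
                - (\<Sum>m\<in>?L. c (Inr (Inr m)) * Am a m k)" for k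
          using fin by (simp add: S_def A_def sum.Plus sum_negf)
        with c have "\<forall>k<nbus a. c (Inl ()) + (\<Sum>r\<in>?C. c (Inr (Inl r)) * Gc a r k)
                - (\<Sum>m\<in>?L. c (Inr (Inr m)) * Am a m k) = 0" by simp
        with g(2)[unfolded primal_nondeg_def, rule_format, of "c (Inl ())" "\<lambda>r. c (Inr (Inl r))" "\<lambda>m. c (Inr (Inr m))"]
        show "\<forall>s\<in>S. c s = 0" by (auto simp: S_def)
      qed
    qed
    then obtain u0 where u0: "\<And>s. s \<in> S \<Longrightarrow> (\<Sum>k<nbus a. A s k * u0 k) = b s" by blast
    \<comment> \<open>Cut off outside the index range, since \<open>feas\<close> admits only vectors
      vanishing there.\<close>
    define u where "u k = (if k < nbus a then u0 k else 0)" for k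
    have u: "(\<Sum>k<nbus a. A s k * u k) = b s" if "s \<in> S" for s
      using u0[OF that] by (simp add: u_def)
    have "Inl () \<in> S" by (auto simp: S_def)
    from u[OF this] have ubal: "(\<Sum>k<nbus a. u k) = (\<Sum>i\<in>{1..I}. r i)"
      by (simp add: A_def b_def)
    have ucon: "(\<Sum>k<nbus a. Gc a s k * u k) = 0" if "s \<in> ?C" for s
      using u[of "Inr (Inl s)"] that by (auto simp: S_def A_def b_def)
    have uline: "(\<Sum>k<nbus a. Am a m k * u k) = (\<Sum>i\<in>{1..I}. Bm a m i * r i)" if "m \<in> ?L" for m
      using u[of "Inr (Inr m)"] that by (auto simp: S_def A_def b_def sum_negf)
    \<comment> \<open>Inactive rows keep some slack for small \<open>h\<close>; active rows have
      slope zero by the choice of \<open>u\<close>.\<close>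
    have slack: "\<forall>\<^sub>F h in at_right 0. \<alpha> + h * \<beta> \<le> \<gamma>" if "\<alpha> < \<gamma> \<or> (\<alpha> \<le> \<gamma> \<and> \<beta> = 0)" for \<alpha> \<beta> \<gamma> :: real
      using that
    proof
      assume "\<alpha> < \<gamma>"
      moreover have "((\<lambda>h. \<alpha> + h * \<beta>) \<longlongrightarrow> \<alpha> + 0 * \<beta>) (at_right 0)"
        by (intro tendsto_intros)
      ultimately have "\<forall>\<^sub>F h in at_right 0. \<alpha> + h * \<beta> < \<gamma>" by (auto dest: order_tendstoD(2))
      then show ?thesis by eventually_elim simp
    qed simp
    have "\<forall>\<^sub>F h in at_right 0. \<forall>s\<in>{..<ncon a}.
        (\<Sum>k<nbus a. Gc a s k * g k) + h * (\<Sum>k<nbus a. Gc a s k * u k) \<le> gb a s"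
    proof (rule eventually_ball_finite, simp, intro ballI slack)
      fix s assume "s \<in> {..<ncon a}"
      with gf have "(\<Sum>k<nbus a. Gc a s k * g k) < gb a s \<or> s \<in> ?C" "(\<Sum>k<nbus a. Gc a s k * g k) \<le> gb a s"
        by (auto simp: feas_def act_con_def order_le_less)
      then show "(\<Sum>k<nbus a. Gc a s k * g k) < gb a s \<or>
          (\<Sum>k<nbus a. Gc a s k * g k) \<le> gb a s \<and> (\<Sum>k<nbus a. Gc a s k * u k) = 0"
        using ucon by blast
    qed
    moreover have "\<forall>\<^sub>F h in at_right 0. \<forall>m\<in>{..<nline a}.
        ((\<Sum>k<nbus a. Am a m k * (d k - g k)) + (\<Sum>i\<in>{1..I}. Bm a m i * qn i))
         + h * ((\<Sum>i\<in>{1..I}. Bm a m i * r i) - (\<Sum>k<nbus a. Am a m k * u k)) \<le> Fv a m"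
    proof (rule eventually_ball_finite, simp, intro ballI slack)
      fix m assume "m \<in> {..<nline a}"
      with gf have "(\<Sum>k<nbus a. Am a m k * (d k - g k)) + (\<Sum>i\<in>{1..I}. Bm a m i * qn i) < Fv a m \<or> m \<in> ?L"
        "(\<Sum>k<nbus a. Am a m k * (d k - g k)) + (\<Sum>i\<in>{1..I}. Bm a m i * qn i) \<le> Fv a m"
        by (auto simp: feas_def act_line_def order_le_less)
      then show "(\<Sum>k<nbus a. Am a m k * (d k - g k)) + (\<Sum>i\<in>{1..I}. Bm a m i * qn i) < Fv a m \<or>
          (\<Sum>k<nbus a. Am a m k * (d k - g k)) + (\<Sum>i\<in>{1..I}. Bm a m i * qn i) \<le> Fv a m \<and>
          (\<Sum>i\<in>{1..I}. Bm a m i * r i) - (\<Sum>k<nbus a. Am a m k * u k) = 0"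
        using uline by auto
    qed
    ultimately have "\<forall>\<^sub>F h in at_right 0. (\<lambda>k. g k + h * u k) \<in> feas a I (\<lambda>i. qn i + h * r i) d"
    proof eventually_elim
      case (elim h)
      have c: "(\<Sum>k<nbus a. Gc a s k * (g k + h * u k))
          = (\<Sum>k<nbus a. Gc a s k * g k) + h * (\<Sum>k<nbus a. Gc a s k * u k)" for s
        by (simp add: sum_distrib_left sum.distrib algebra_simps)
      have l: "(\<Sum>k<nbus a. Am a m k * (d k - (g k + h * u k))) + (\<Sum>i\<in>{1..I}. Bm a m i * (qn i + h * r i))
         = ((\<Sum>k<nbus a. Am a m k * (d k - g k)) + (\<Sum>i\<in>{1..I}. Bm a m i * qn i))
         + h * ((\<Sum>i\<in>{1..I}. Bm a m i * r i) - (\<Sum>k<nbus a. Am a m k * u k))" for m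
        by (simp add: sum_distrib_left sum.distrib algebra_simps sum_subtractf)
      have b: "(\<Sum>k<nbus a. d k - (g k + h * u k)) + (\<Sum>i\<in>{1..I}. qn i + h * r i)
         = (\<Sum>k<nbus a. d k - g k) + (\<Sum>i\<in>{1..I}. qn i)"
        using ubal by (simp add: sum.distrib sum_subtractf sum_distrib_left[symmetric])
      show ?case
        using elim gf unfolding feas_def mem_Collect_eq c l b by (auto simp: u_def)
    qed
    \<comment> \<open>The expansion being exact, \<open>K\<close> is half the quadratic form of
      \<open>u\<close>, and the KKT conditions turn the linear term into \<open>lam\<close>.\<close>
    moreover have "gcost a (\<lambda>k. g k + h * u k) = gcost a g + h * (\<Sum>i\<in>{1..I}. lam i * r i) + quad_form a u / 2 * h\<^sup>2" for h
    proof -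
      have "(\<Sum>k<nbus a. cost_grad a g k * u k) = (\<Sum>i\<in>{1..I}. lam i * r i)"
        unfolding kkt lamsum using ucon uline ubal by simp
      moreover have "(\<Sum>k<nbus a. cost_grad a g k * (h * u k)) = h * (\<Sum>k<nbus a. cost_grad a g k * u k)"
        by (simp add: sum_distrib_left mult_ac)
      ultimately show ?thesis by (simp add: gcost_add[OF pd] quad_form_scale)
    qed
    ultimately have "\<forall>\<^sub>F h in at_right 0. \<exists>g'\<in>feas a I (\<lambda>i. qn i + h * r i) d.
             gcost a g' \<le> gcost a g + h * (\<Sum>i\<in>{1..I}. lam i * r i) + quad_form a u / 2 * h\<^sup>2"
      by (auto elim!: eventually_mono intro!: bexI[of _ "\<lambda>k. g k + _ * u k"])
    then show ?thesis by blast
  qed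
  show ?thesis unfolding gs using lower upper by blast
qed

subsection \<open>Cyclic coordinate descent\<close>

text \<open>Some residue class is visited infinitely often. Along such a subsequence the coordinate
  to be updated next is always the same.\<close>

lemma constant_residue_subsequence:
  fixes \<sigma> :: "nat \<Rightarrow> nat"
  assumes "strict_mono \<sigma>" "0 < I"
  shows "\<exists>r (\<rho> :: nat \<Rightarrow> nat). strict_mono \<rho> \<and> (\<forall>k. \<sigma> (\<rho> k) mod I = r)"
proof -
  have "\<exists>r\<in>{..<I}. infinite {k \<in> UNIV. \<sigma> k mod I = r}"
    by (rule pigeonhole_infinite_rel) (use assms in auto)
  then obtain r where inf: "infinite {k. \<sigma> k mod I = r}" by auto
  have "strict_mono (enumerate {k. \<sigma> k mod I = r})"
    using inf by (simp add: strict_mono_enumerate)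
  moreover have "\<sigma> (enumerate {k. \<sigma> k mod I = r} k) mod I = r" for k
    using enumerate_in_set[OF inf, of k] by simp
  ultimately show ?thesis by blast
qed

definition capped :: "nat \<Rightarrow> (nat \<Rightarrow> real) \<Rightarrow> (nat \<Rightarrow> real) set" where
  "capped I Q = {q. \<forall>i\<in>{1..I}. q i \<le> Q i}"

text \<open>\<open>coord\<close> asks for minimality only in the coordinates where the two points
  differ, because at the intermediate limits it is known for some coordinates only.
  \<open>step\<close> takes the place of compactness, as the capped set is unbounded below.\<close>

lemma cyclic_descent_limit_point_minimizes:
  fixes f :: "(nat \<Rightarrow> real) \<Rightarrow> real"
  assumes I: "0 < I"
    and cong: "\<And>x y. (\<forall>i\<in>{1..I}. x i = y i) \<Longrightarrow> f x = f y"
    and cont: "\<And>X x. \<forall>k. X k \<in> capped I Q \<Longrightarrow> \<forall>i\<in>{1..I}. (\<lambda>k. X k i) \<longlonglongrightarrow> x i \<Longrightarrow> (\<lambda>k. f (X k)) \<longlonglongrightarrow> f x"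
    and coord: "\<And>x y. x \<in> capped I Q \<Longrightarrow> y \<in> capped I Q \<Longrightarrow>
        \<forall>i\<in>{1..I}. y i \<noteq> x i \<longrightarrow> (\<forall>z\<le>Q i. f x \<le> f (x(i := z))) \<Longrightarrow> f x \<le> f y"
    and step: "\<And>l. \<exists>R. \<forall>x\<in>capped I Q. \<forall>i\<in>{1..I}. \<forall>y. x(i := y) \<in> capped I Q \<longrightarrow>
        f x \<le> l \<longrightarrow> f (x(i := y)) \<le> l \<longrightarrow> \<bar>y - x i\<bar> \<le> R"
    and feasible: "\<And>t. q t \<in> capped I Q"
    and keep: "\<And>t j. j \<in> {1..I} \<Longrightarrow> j \<noteq> t mod I + 1 \<Longrightarrow> q (Suc t) j = q t j"
    and min: "\<And>t x. x \<le> Q (t mod I + 1) \<Longrightarrow> f (q (Suc t)) \<le> f ((q t)(t mod I + 1 := x))"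
    and \<sigma>: "strict_mono (\<sigma> :: nat \<Rightarrow> nat)"
    and lim: "\<forall>i\<in>{1..I}. (\<lambda>k. q (\<sigma> k) i) \<longlonglongrightarrow> p i"
    and y: "y \<in> capped I Q"
  shows "f p \<le> f y"
proof -
  have idx: "t mod I + 1 \<in> {1..I}" for t using I by (simp add: Suc_leI)
  have dec: "decseq (\<lambda>t. f (q t))"
  proof (rule decseq_SucI)
    fix t
    show "f (q (Suc t)) \<le> f (q t)"
      using min[of "q t (t mod I + 1)" t] feasible[of t] idx[of t] by (simp add: capped_def)
  qed
  have limit_capped: "w \<in> capped I Q" if "\<forall>k. X k \<in> capped I Q" "\<forall>i\<in>{1..I}. (\<lambda>k. X k i) \<longlonglongrightarrow> w i" for X w
    unfolding capped_def
  proof (intro CollectI ballI)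
    fix i assume i: "i \<in> {1..I}"
    show "w i \<le> Q i"
      by (rule LIMSEQ_le_const2[of "\<lambda>k. X k i"]) (use that i in \<open>auto simp: capped_def\<close>)
  qed
  \<comment> \<open>\<open>w\<close> is a limit of iterates at times congruent to \<open>r\<close>.
    Times count from 0 and coordinates from 1, so the coordinate changed next is
    \<open>r mod I + 1\<close>.\<close>
  define L where "L r w \<longleftrightarrow> (\<exists>\<tau>. strict_mono \<tau> \<and> (\<forall>k::nat. \<tau> k mod I = r mod I) \<and>
      (\<forall>i\<in>{1..I}. (\<lambda>k. q (\<tau> k) i) \<longlonglongrightarrow> w i))" for r w
  have value_lim: "(\<lambda>t. f (q t)) \<longlonglongrightarrow> f p"
  proof -
    have sub: "(\<lambda>k. f (q (\<sigma> k))) \<longlonglongrightarrow> f p" using cont[of "\<lambda>k. q (\<sigma> k)" p] feasible lim by blast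
    have "f p \<le> f (q t)" for t
    proof (rule LIMSEQ_le_const2[OF sub], intro exI[of _ t] allI impI)
      fix k assume "t \<le> k"
      then have "t \<le> \<sigma> k" using seq_suble[OF \<sigma>, of k] by linarith
      with dec show "f (q (\<sigma> k)) \<le> f (q t)" by (auto simp: decseq_def)
    qed
    with dec obtain l where l: "(\<lambda>t. f (q t)) \<longlonglongrightarrow> l" using decseq_convergent by blast
    with sub \<sigma> have "l = f p" using LIMSEQ_subseq_LIMSEQ[OF l \<sigma>] by (auto simp: o_def intro: LIMSEQ_unique)
    with l show ?thesis by simp
  qed
  have L_value: "f w = f p" if w: "L r w" for r w
  proof -
    from w obtain \<tau> where t: "strict_mono \<tau>" "\<forall>i\<in>{1..I}. (\<lambda>k. q (\<tau> k) i) \<longlonglongrightarrow> w i"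
      unfolding L_def by blast
    have "(\<lambda>k. f (q (\<tau> k))) \<longlonglongrightarrow> f w" using cont[of "\<lambda>k. q (\<tau> k)" w] feasible t by blast
    moreover have "(\<lambda>k. f (q (\<tau> k))) \<longlonglongrightarrow> f p"
      using LIMSEQ_subseq_LIMSEQ[OF value_lim t(1)] by (simp add: o_def)
    ultimately show ?thesis by (rule LIMSEQ_unique)
  qed
  have L_capped: "w \<in> capped I Q" if "L r w" for r w
    using that limit_capped[of "\<lambda>k. q (_ k)" w] feasible unfolding L_def by blast
  have next_limit: "\<exists>v. L (Suc r) (w(r mod I + 1 := v)) \<and>
      (\<forall>z\<le>Q (r mod I + 1). f p \<le> f (w(r mod I + 1 := z)))" if w: "L r w" for r w
  proof -
    define i where "i = r mod I + 1"
    have i: "i \<in> {1..I}" unfolding i_def by (rule idx)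
    from w obtain \<tau> where \<tau>: "strict_mono \<tau>" "\<And>k. \<tau> k mod I = r mod I"
      "\<And>j. j \<in> {1..I} \<Longrightarrow> (\<lambda>k. q (\<tau> k) j) \<longlonglongrightarrow> w j"
      unfolding L_def by blast
    have upd: "f (q (Suc (\<tau> k))) = f ((q (\<tau> k))(i := q (Suc (\<tau> k)) i))" for k
      by (rule cong) (use keep[of _ "\<tau> k"] \<tau>(2) in \<open>auto simp: i_def\<close>)
    \<comment> \<open>Both ends of every step lie in the sublevel set of the initial value, so a
      single bound serves all steps in coordinate \<open>i\<close>.\<close>
    obtain R where R: "\<And>x y. x \<in> capped I Q \<Longrightarrow> x(i := y) \<in> capped I Q \<Longrightarrow>
        f x \<le> f (q 0) \<Longrightarrow> f (x(i := y)) \<le> f (q 0) \<Longrightarrow> \<bar>y - x i\<bar> \<le> R"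
      using step[of "f (q 0)"] i by blast
    have le0: "f (q t) \<le> f (q 0)" for t using dec by (auto simp: decseq_def)
    have dist: "\<bar>q (Suc (\<tau> k)) i - q (\<tau> k) i\<bar> \<le> R" for k
    proof (rule R[OF feasible])
      show "(q (\<tau> k))(i := q (Suc (\<tau> k)) i) \<in> capped I Q"
        using feasible[of "\<tau> k"] feasible[of "Suc (\<tau> k)"] by (auto simp: capped_def)
    qed (use le0 upd[symmetric] in auto)
    obtain S where S: "\<And>k. \<bar>q (\<tau> k) i\<bar> \<le> S"
      using convergent_imp_Bseq[OF convergentI[OF \<tau>(3)[OF i]]] unfolding Bseq_def by auto
    have "\<bar>q (Suc (\<tau> k)) i\<bar> \<le> R + S" for k
      using dist[of k] S[of k] by linarith
    then have "bounded (range (\<lambda>k. q (Suc (\<tau> k)) i))" by (auto simp: bounded_iff)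
    then obtain v \<rho> where \<rho>: "strict_mono \<rho>" and v: "((\<lambda>k. q (Suc (\<tau> k)) i) \<circ> \<rho>) \<longlonglongrightarrow> v"
      using bounded_imp_convergent_subsequence by blast
    have lim1: "(\<lambda>k. q (\<tau> (\<rho> k)) j) \<longlonglongrightarrow> w j" if "j \<in> {1..I}" for j
      using LIMSEQ_subseq_LIMSEQ[OF \<tau>(3)[OF that] \<rho>] by (simp add: o_def)
    have lim2: "(\<lambda>k. q (Suc (\<tau> (\<rho> k))) j) \<longlonglongrightarrow> (w(i := v)) j" if "j \<in> {1..I}" for j
    proof (cases "j = i")
      case True with v show ?thesis by (simp add: o_def)
    next
      case False
      then show ?thesis using lim1[OF that] keep[OF that, of "\<tau> _"] \<tau>(2) by (simp add: i_def)
    qed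
    have "L (Suc r) (w(i := v))"
      unfolding L_def
    proof (intro exI[of _ "\<lambda>k. Suc (\<tau> (\<rho> k))"] conjI allI ballI)
      show "strict_mono (\<lambda>k. Suc (\<tau> (\<rho> k)))" using \<tau>(1) \<rho> by (simp add: strict_mono_def)
      show "Suc (\<tau> (\<rho> k)) mod I = Suc r mod I" for k using \<tau>(2)[of "\<rho> k"] by (metis mod_Suc_eq)
    qed (rule lim2)
    \<comment> \<open>Minimality of the new iterates survives the limit: the left side tends to the
      common value of all limits, the right side converges by \<open>cont\<close>.\<close>
    moreover have "f p \<le> f (w(i := z))" if z: "z \<le> Q i" for z
    proof (rule LIMSEQ_le)
      show "(\<lambda>k. f (q (Suc (\<tau> (\<rho> k))))) \<longlonglongrightarrow> f p"
        using LIMSEQ_subseq_LIMSEQ[OF value_lim, of "\<lambda>k. Suc (\<tau> (\<rho> k))"] \<tau>(1) \<rho>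
        by (simp add: strict_mono_def o_def)
      show "(\<lambda>k. f ((q (\<tau> (\<rho> k)))(i := z))) \<longlonglongrightarrow> f (w(i := z))"
        by (rule cont) (use feasible z lim1 in \<open>auto simp: capped_def\<close>)
      show "\<exists>N. \<forall>n\<ge>N. f (q (Suc (\<tau> (\<rho> n)))) \<le> f ((q (\<tau> (\<rho> n)))(i := z))"
        using min[of z "\<tau> _"] z \<tau>(2) by (simp add: i_def)
    qed
    ultimately show ?thesis unfolding i_def by blast
  qed
  \<comment> \<open>Extending the window by one coordinate: the limit \<open>w(i := v)\<close> of the successors minimizes \<open>f\<close> in the
      coordinate \<open>i\<close> just updated and, inductively, in the next \<open>j\<close> ones, hence jointly in all of them;
      \<open>w\<close> lies in the same coordinate subspace and has the same value.\<close>
  have window: "\<forall>s\<in>{r..<r+j}. \<forall>z\<le>Q (s mod I + 1). f w \<le> f (w(s mod I + 1 := z))" if "L r w" for r w j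
    using that
  proof (induction j arbitrary: r w)
    case 0 then show ?case by simp
  next
    case (Suc j)
    define i where "i = r mod I + 1"
    obtain v where v: "L (Suc r) (w(i := v))" and cm: "\<And>z. z \<le> Q i \<Longrightarrow> f p \<le> f (w(i := z))"
      using next_limit[OF Suc.prems] unfolding i_def by blast
    have fv: "f (w(i := v)) = f p" and fw: "f w = f p" using L_value v Suc.prems by auto
    show ?case
    proof (intro ballI allI impI)
      fix s z assume s: "s \<in> {r..<r + Suc j}" and z: "z \<le> Q (s mod I + 1)"
      have "f (w(i := v)) \<le> f (w(s mod I + 1 := z))"
      proof (rule coord)
        show "w(i := v) \<in> capped I Q" by (rule L_capped[OF v])
        show "w(s mod I + 1 := z) \<in> capped I Q" using L_capped[OF Suc.prems] z by (auto simp: capped_def)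
        show "\<forall>l\<in>{1..I}. (w(s mod I + 1 := z)) l \<noteq> (w(i := v)) l \<longrightarrow>
            (\<forall>x\<le>Q l. f (w(i := v)) \<le> f ((w(i := v))(l := x)))"
        proof (intro ballI impI allI)
          fix l x assume l: "(w(s mod I + 1 := z)) l \<noteq> (w(i := v)) l" and x: "x \<le> Q l"
          show "f (w(i := v)) \<le> f ((w(i := v))(l := x))"
          proof (cases "l = i")
            case True then show ?thesis using cm x fv by simp
          next
            case False
            with l have ls: "l = s mod I + 1" by (auto split: if_splits)
            with False have "s \<noteq> r" by (auto simp: i_def)
            with s have "s \<in> {Suc r..<Suc r + j}" by auto
            then show ?thesis using Suc.IH[OF v] x ls by blast
          qed
        qed
      qed
      then show "f w \<le> f (w(s mod I + 1 := z))" using fv fw by simp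
    qed
  qed
  obtain r and \<rho> :: "nat \<Rightarrow> nat" where \<rho>: "strict_mono \<rho>" "\<And>k. \<sigma> (\<rho> k) mod I = r"
    using constant_residue_subsequence[OF \<sigma> I] by blast
  have "L r p" unfolding L_def
  proof (intro exI[of _ "\<lambda>k. \<sigma> (\<rho> k)"] conjI allI ballI)
    show "strict_mono (\<lambda>k. \<sigma> (\<rho> k))" using \<sigma> \<rho> by (simp add: strict_mono_def)
    show "\<sigma> (\<rho> k) mod I = r mod I" for k using \<rho>(2)[of k] by (metis mod_mod_trivial)
    show "(\<lambda>k. q (\<sigma> (\<rho> k)) i) \<longlonglongrightarrow> p i" if "i \<in> {1..I}" for i
      using LIMSEQ_subseq_LIMSEQ[OF lim[rule_format, OF that] \<rho>(1)] by (simp add: o_def)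
  qed
  have rI: "r < I" using \<rho>(2)[of 0] I by auto
  show ?thesis
  proof (rule coord[OF L_capped[OF \<open>L r p\<close>] y], intro ballI impI allI)
    fix i z assume i: "i \<in> {1..I}" and z: "z \<le> Q i"
    \<comment> \<open>Any \<open>I\<close> consecutive times update every coordinate;
      \<open>i\<close> is due at times congruent to \<open>i - 1\<close>, shifted by one period if
      \<open>i - 1\<close> precedes the window.\<close>
    have "\<exists>s\<in>{r..<r+I}. s mod I + 1 = i"
    proof (cases "r \<le> i - 1")
      case True then show ?thesis using i by (intro bexI[of _ "i - 1"]) auto
    next
      case False
      have "i - 1 < I" using i by auto
      then have "(i - 1 + I) mod I = i - 1" by simp
      with False i rI show ?thesis by (intro bexI[of _ "i - 1 + I"]) auto
    qed
    then show "f p \<le> f (p(i := z))" using window[OF \<open>L r p\<close>, of I] z by blast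
  qed
qed

subsection \<open>Expected cost\<close>

text \<open>Here \<open>liminf X k \<ge> Y\<close> is expressed by a minorant converging to \<open>Y\<close>.\<close>

lemma integral_lower_limit:
  fixes X :: "nat \<Rightarrow> 'a \<Rightarrow> real"
  assumes X: "\<And>k. integrable M (X k)" and Y: "integrable M Y" and W: "integrable M W"
    and WX: "\<And>k. AE x in M. W x \<le> X k x"
    and Z: "AE x in M. \<exists>Z. Z \<longlonglongrightarrow> Y x \<and> (\<forall>\<^sub>F k in sequentially. Z k \<le> X k x)"
  shows "\<exists>Z. Z \<longlonglongrightarrow> integral\<^sup>L M Y \<and> (\<forall>k. Z k \<le> integral\<^sup>L M (X k))"
proof -
  have int: "integrable M (\<lambda>x. min (X k x) (Y x))" for k
    by (intro Bochner_Integration.integrable_min X Y)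
  \<comment> \<open>Truncating at \<open>Y\<close> from above, with \<open>W\<close> bounding from
    below, permits dominated convergence; truncation only lowers the integrals.\<close>
  have "(\<lambda>k. integral\<^sup>L M (\<lambda>x. min (X k x) (Y x))) \<longlonglongrightarrow> integral\<^sup>L M Y"
  proof (rule integral_dominated_convergence[where w = "\<lambda>x. \<bar>W x\<bar> + \<bar>Y x\<bar>"])
    show "Y \<in> borel_measurable M" using Y by simp
    show "(\<lambda>x. min (X k x) (Y x)) \<in> borel_measurable M" for k by (rule borel_measurable_integrable[OF int])
    show "integrable M (\<lambda>x. \<bar>W x\<bar> + \<bar>Y x\<bar>)" using W Y by simp
    show "AE x in M. (\<lambda>k. min (X k x) (Y x)) \<longlonglongrightarrow> Y x"
      using Z
    proof eventually_elim
      case (elim x)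
      then obtain Z where Z: "Z \<longlonglongrightarrow> Y x" and le: "\<forall>\<^sub>F k in sequentially. Z k \<le> X k x" by blast
      have "(\<lambda>k. min (Z k) (Y x)) \<longlonglongrightarrow> min (Y x) (Y x)" by (intro tendsto_min Z tendsto_const)
      then have lim: "(\<lambda>k. min (Z k) (Y x)) \<longlonglongrightarrow> Y x" by simp
      have "\<forall>\<^sub>F k in sequentially. min (Z k) (Y x) \<le> min (X k x) (Y x)"
        using le by eventually_elim auto
      from tendsto_sandwich[OF this _ lim tendsto_const] show ?case by simp
    qed
    show "AE x in M. norm (min (X k x) (Y x)) \<le> \<bar>W x\<bar> + \<bar>Y x\<bar>" for k
      using WX[of k] by eventually_elim auto
  qed
  moreover have "integral\<^sup>L M (\<lambda>x. min (X k x) (Y x)) \<le> integral\<^sup>L M (X k)" for k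
    by (intro integral_mono int X) simp
  ultimately show ?thesis by (intro exI[of _ "\<lambda>k. integral\<^sup>L M (\<lambda>x. min (X k x) (Y x))"] conjI allI)
qed

lemma filterlim_half_power_at_right: "filterlim (\<lambda>m. (1/2::real) ^ m) (at_right 0) sequentially"
  by (rule tendsto_imp_filterlim_at_right, rule LIMSEQ_realpow_zero) simp_all

lemma qloc_cong: "(\<forall>i\<in>{1..I}. x i = y i) \<Longrightarrow> qloc I orig dest x n = qloc I orig dest y n"
  by (auto simp: qloc_def fun_eq_iff)

lemma qloc_combine:
  "qloc I orig dest (\<lambda>i. s * x i + t * y i) n
     = (\<lambda>i. s * qloc I orig dest x n i + t * qloc I orig dest y n i)"
  by (auto simp: qloc_def fun_eq_iff)

text \<open>In \<open>nondeg\<close> the exceptional null set may depend on \<open>q\<close>. Each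
  pointwise argument below therefore fixes at most countably many interchange vectors before the
  load is chosen.\<close>

locale interchange =
  fixes N I :: nat
    and orig dest :: "nat \<Rightarrow> nat"
    and Q :: "nat \<Rightarrow> real"
    and ar :: "nat \<Rightarrow> area_data"
    and F :: "nat \<Rightarrow> (nat \<Rightarrow> real) measure"
  assumes interfaces: "i \<in> {1..I} \<Longrightarrow> orig i \<in> {1..N} \<and> dest i \<in> {1..N} \<and> orig i \<noteq> dest i"
    and pd: "n \<in> {1..N} \<Longrightarrow> posdef (ar n)"
    and F_prob: "n \<in> {1..N} \<Longrightarrow> prob_space (F n)"
    and nondeg: "n \<in> {1..N} \<Longrightarrow> q \<in> capped I Q \<Longrightarrow>
        AE d in F n. nondegenerate (ar n) I (qloc I orig dest q n) d"
    and integrable_cost: "n \<in> {1..N} \<Longrightarrow> q \<in> capped I Q \<Longrightarrow>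
        integrable (F n) (\<lambda>d. gcost (ar n) (gstar (ar n) I (qloc I orig dest q n) d))"
begin

abbreviation loc :: "(nat \<Rightarrow> real) \<Rightarrow> nat \<Rightarrow> nat \<Rightarrow> real" where
  "loc q n \<equiv> qloc I orig dest q n"

definition val :: "nat \<Rightarrow> (nat \<Rightarrow> real) \<Rightarrow> (nat \<Rightarrow> real) \<Rightarrow> real" where
  "val n q d = gcost (ar n) (gstar (ar n) I (loc q n) d)"

abbreviation f :: "(nat \<Rightarrow> real) \<Rightarrow> real" where
  "f \<equiv> Cbar N I orig dest ar F"

lemma f_eq: "f q = (\<Sum>n\<in>{1..N}. integral\<^sup>L (F n) (val n q))"
  by (simp add: Cbar_def val_def[abs_def])

lemma val_integrable: "n \<in> {1..N} \<Longrightarrow> q \<in> capped I Q \<Longrightarrow> integrable (F n) (val n q)"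
  using integrable_cost by (simp add: val_def[abs_def])

lemma f_cong: "(\<forall>i\<in>{1..I}. x i = y i) \<Longrightarrow> f x = f y"
  using qloc_cong[of I x y] by (simp add: Cbar_def)

lemma gstar_opt:
  assumes "n \<in> {1..N}" "nondegenerate (ar n) I (loc q n) d"
  shows "is_opt (ar n) I (loc q n) d (gstar (ar n) I (loc q n) d)"
proof -
  obtain g where g: "is_opt (ar n) I (loc q n) d g" using assms(2) unfolding nondegenerate_def by blast
  then show ?thesis using gstar_eq[OF pd[OF assms(1)] g] by simp
qed

lemma val_le:
  assumes "n \<in> {1..N}" "nondegenerate (ar n) I (loc q n) d" "g \<in> feas (ar n) I (loc q n) d"
  shows "val n q d \<le> gcost (ar n) g"
  using gstar_opt[OF assms(1,2)] assms(3) by (simp add: val_def is_opt_def)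

section \<open>Convexity and coordinatewise minima of the expected cost\<close>

lemma capped_combine:
  assumes "x \<in> capped I Q" "y \<in> capped I Q" "0 \<le> t" "t \<le> 1"
  shows "(\<lambda>i. (1 - t) * x i + t * y i) \<in> capped I Q"
  using assms by (auto simp: capped_def intro!: convex_bound_le)

text \<open>The mixture of the two optimal generations is feasible for the mixed interchange, and
  its cost bounds the optimal one there.\<close>

lemma val_convex:
  assumes n: "n \<in> {1..N}" and x: "x \<in> capped I Q" and y: "y \<in> capped I Q" and t: "0 \<le> t" "t \<le> 1"
  shows "AE d in F n. val n (\<lambda>i. (1 - t) * x i + t * y i) d \<le> (1 - t) * val n x d + t * val n y d"
  using nondeg[OF n x] nondeg[OF n y] nondeg[OF n capped_combine[OF x y t]]
proof eventually_elim
  case (elim d)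
  have "(\<lambda>k. (1 - t) * gstar (ar n) I (loc x n) d k + t * gstar (ar n) I (loc y n) d k)
      \<in> feas (ar n) I (loc (\<lambda>i. (1 - t) * x i + t * y i) n) d"
    unfolding qloc_combine
    using gstar_opt[OF n elim(1)] gstar_opt[OF n elim(2)] t by (intro feas_convex) (auto simp: is_opt_def)
  from val_le[OF n elim(3) this] gcost_convex[OF pd[OF n] t]
  show ?case by (fastforce simp: val_def intro: order_trans)
qed

lemma f_convex:
  assumes x: "x \<in> capped I Q" and y: "y \<in> capped I Q" and t: "0 \<le> t" "t \<le> 1"
  shows "f (\<lambda>i. (1 - t) * x i + t * y i) \<le> (1 - t) * f x + t * f y"
proof -
  have "integral\<^sup>L (F n) (val n (\<lambda>i. (1 - t) * x i + t * y i))
      \<le> (1 - t) * integral\<^sup>L (F n) (val n x) + t * integral\<^sup>L (F n) (val n y)" if n: "n \<in> {1..N}" for n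
  proof -
    have "integral\<^sup>L (F n) (val n (\<lambda>i. (1 - t) * x i + t * y i))
        \<le> integral\<^sup>L (F n) (\<lambda>d. (1 - t) * val n x d + t * val n y d)"
      using val_integrable[OF n x] val_integrable[OF n y] val_integrable[OF n capped_combine[OF x y t]]
      by (intro integral_mono_AE val_convex n x y t) auto
    also have "\<dots> = (1 - t) * integral\<^sup>L (F n) (val n x) + t * integral\<^sup>L (F n) (val n y)"
      using val_integrable[OF n x] val_integrable[OF n y] by simp
    finally show ?thesis .
  qed
  then show ?thesis
    unfolding f_eq sum_distrib_left sum.distrib[symmetric] by (intro sum_mono)
qed

text \<open>For a fixed load, the limit superior of the summed coordinate quotients from
  \<open>x\<close> towards \<open>y\<close> is at most \<open>lam\<close> applied to the whole move,
  hence at most \<open>val n y d - val n x d\<close>. Coordinatewise minimality makes the total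
  expected quotients nonnegative, so \<open>f y - f x\<close> cannot be negative.\<close>

lemma f_coordinatewise_min:
  assumes x: "x \<in> capped I Q" and y: "y \<in> capped I Q"
    and min: "\<forall>i\<in>{1..I}. y i \<noteq> x i \<longrightarrow> (\<forall>z\<le>Q i. f x \<le> f (x(i := z)))"
  shows "f x \<le> f y"
proof -
  \<comment> \<open>\<open>X i h\<close> moves only coordinate \<open>i\<close>, by the fraction
    \<open>h\<close> of the way from \<open>x\<close> to \<open>y\<close>.\<close>
  define X where "X i h = (\<lambda>j. (1 - h) * x j + h * (x(i := y i)) j)" for i and h :: real
  have xy: "x(i := y i) \<in> capped I Q" if "i \<in> {1..I}" for i
    using x y that by (auto simp: capped_def)
  have Xbox: "X i h \<in> capped I Q" if "i \<in> {1..I}" "0 \<le> h" "h \<le> 1" for i h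
    unfolding X_def by (intro capped_combine x xy that)
  have X1: "X i 1 = x(i := y i)" for i by (simp add: X_def fun_eq_iff)
  have Xupd: "X i h = x(i := x i + h * (y i - x i))" for i h
    by (auto simp: X_def fun_eq_iff algebra_simps)
  have fX: "f x \<le> f (X i h)" if i: "i \<in> {1..I}" and h: "0 \<le> h" "h \<le> 1" for i h
  proof (cases "y i = x i")
    case True then show ?thesis by (simp add: Xupd)
  next
    case False
    have "X i h i \<le> Q i" using Xbox[OF i h] i by (simp add: capped_def)
    with False min i show ?thesis by (auto simp: Xupd)
  qed
  \<comment> \<open>The sum over all coordinates of the difference quotients with step
    \<open>(1/2) ^ m\<close>. Only countably many points occur, so one null set serves them
    all.\<close>
  define D where "D n m d = (\<Sum>i\<in>{1..I}. 2 ^ m * (val n (X i ((1/2) ^ m)) d - val n x d))" for n m d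
  have h01: "0 \<le> (1/2::real) ^ m" "(1/2::real) ^ m \<le> 1" for m by (auto simp: power_le_one)
  have scale: "2 ^ m * (1/2::real) ^ m = 1" for m by (simp add: power_mult_distrib[symmetric])
  have rescale: "b * (a * s + k * a\<^sup>2) = s + k * a" if "b * a = 1" for a b s k :: real
  proof -
    have "b * (a * s + k * a\<^sup>2) = (b * a) * s + k * ((b * a) * a)"
      by (simp add: algebra_simps power2_eq_square)
    with that show ?thesis by simp
  qed
  have Dint: "integrable (F n) (D n m)" if n: "n \<in> {1..N}" for n m
    unfolding D_def[abs_def]
    by (intro Bochner_Integration.integrable_sum integrable_mult_right Bochner_Integration.integrable_diff
          val_integrable n x Xbox h01)
  have "\<forall>n\<in>{1..N}. \<exists>Z. Z \<longlonglongrightarrow> integral\<^sup>L (F n) (\<lambda>d. val n x d - val n y d) \<and>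
      (\<forall>m. Z m \<le> integral\<^sup>L (F n) (\<lambda>d. - D n m d))"
  proof
    fix n assume n: "n \<in> {1..N}"
    show "\<exists>Z. Z \<longlonglongrightarrow> integral\<^sup>L (F n) (\<lambda>d. val n x d - val n y d) \<and>
      (\<forall>m. Z m \<le> integral\<^sup>L (F n) (\<lambda>d. - D n m d))"
    proof (rule integral_lower_limit)
      show "integrable (F n) (\<lambda>d. - D n m d)" for m using Dint[OF n] by simp
      show "integrable (F n) (\<lambda>d. val n x d - val n y d)" using val_integrable n x y by simp
      show "integrable (F n) (\<lambda>d. - D n 0 d)" using Dint[OF n] by simp
      \<comment> \<open>By convexity a quotient is at most the one for the full step
        \<open>m = 0\<close>, which serves as the integrable bound.\<close>
      show "AE d in F n. - D n 0 d \<le> - D n m d" for m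
      proof -
        have "AE d in F n. \<forall>i\<in>{1..I}. val n (X i ((1/2) ^ m)) d
            \<le> (1 - (1/2)^m) * val n x d + (1/2)^m * val n (x(i := y i)) d"
          unfolding X_def by (intro AE_finite_allI val_convex n x xy h01) auto
        then show ?thesis
        proof eventually_elim
          case (elim d)
          have "2 ^ m * (val n (X i ((1/2) ^ m)) d - val n x d) \<le> val n (x(i := y i)) d - val n x d"
            if "i \<in> {1..I}" for i
          proof -
            have "val n (X i ((1/2) ^ m)) d - val n x d \<le> (1/2)^m * (val n (x(i := y i)) d - val n x d)"
              using elim that by (auto simp: algebra_simps)
            then have "2 ^ m * (val n (X i ((1/2) ^ m)) d - val n x d)
                \<le> 2 ^ m * ((1/2)^m * (val n (x(i := y i)) d - val n x d))"
              by (intro mult_left_mono) auto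
            then show ?thesis by (simp only: mult.assoc[symmetric] scale mult_1)
          qed
          then show ?case by (auto simp: D_def X1 intro!: sum_mono)
        qed
      qed
      have "AE d in F n. \<forall>m. \<forall>i\<in>{1..I}. nondegenerate (ar n) I (loc (X i ((1/2)^m)) n) d"
        unfolding AE_all_countable by (intro allI AE_finite_allI nondeg n Xbox h01) auto
      with nondeg[OF n x] nondeg[OF n y]
      show "AE d in F n. \<exists>Z. Z \<longlonglongrightarrow> val n x d - val n y d \<and> (\<forall>\<^sub>F m in sequentially. Z m \<le> - D n m d)"
      proof eventually_elim
        case (elim d)
        note ndX = elim(3)
        \<comment> \<open>The local flow change caused by moving coordinate \<open>i\<close> alone;
          \<open>loc\<close> acts entry by entry, so these changes add up to the whole move.\<close>
        define R where "R i = loc (\<lambda>j. if j = i then y i - x i else 0) n" for i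
        obtain lam where lower: "\<And>qn' g'. g' \<in> feas (ar n) I qn' d \<Longrightarrow>
             val n x d + (\<Sum>j\<in>{1..I}. lam j * (qn' j - loc x n j)) \<le> gcost (ar n) g'"
          and upper: "\<And>r. \<exists>K. \<forall>\<^sub>F h in at_right 0. \<exists>g'\<in>feas (ar n) I (\<lambda>j. loc x n j + h * r j) d.
             gcost (ar n) g' \<le> val n x d + h * (\<Sum>j\<in>{1..I}. lam j * r j) + K * h\<^sup>2"
          using nondegenerate_first_order[OF pd[OF n] elim(1)] unfolding val_def by blast
        have "\<forall>i. \<exists>K. \<forall>\<^sub>F h in at_right 0. \<exists>g'\<in>feas (ar n) I (\<lambda>j. loc x n j + h * R i j) d.
             gcost (ar n) g' \<le> val n x d + h * (\<Sum>j\<in>{1..I}. lam j * R i j) + K * h\<^sup>2"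
          by (intro allI upper)
        from choice[OF this] obtain K where
          K: "\<And>i. \<forall>\<^sub>F h in at_right 0. \<exists>g'\<in>feas (ar n) I (\<lambda>j. loc x n j + h * R i j) d.
             gcost (ar n) g' \<le> val n x d + h * (\<Sum>j\<in>{1..I}. lam j * R i j) + K i * h\<^sup>2"
          by blast
        have locX: "loc (X i h) n = (\<lambda>j. loc x n j + h * R i j)" for i h
          using qloc_combine[of I orig dest 1 x h "\<lambda>j. if j = i then y i - x i else 0" n]
          by (auto simp: R_def Xupd fun_eq_iff qloc_def)
        have "\<forall>\<^sub>F m in sequentially. \<forall>i\<in>{1..I}. \<exists>g'\<in>feas (ar n) I (loc (X i ((1/2)^m)) n) d.
             gcost (ar n) g' \<le> val n x d + (1/2)^m * (\<Sum>j\<in>{1..I}. lam j * R i j) + K i * ((1/2)^m)\<^sup>2"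
          unfolding locX
          by (intro eventually_ball_finite ballI
                eventually_compose_filterlim[OF K filterlim_half_power_at_right]) auto
        then have ev: "\<forall>\<^sub>F m in sequentially. \<forall>i\<in>{1..I}. val n (X i ((1/2)^m)) d
            \<le> val n x d + (1/2)^m * (\<Sum>j\<in>{1..I}. lam j * R i j) + K i * ((1/2)^m)\<^sup>2"
        proof eventually_elim
          case (elim m)
          show ?case
          proof
            fix i assume i: "i \<in> {1..I}"
            with elim obtain g' where g': "g' \<in> feas (ar n) I (loc (X i ((1/2)^m)) n) d"
              and le: "gcost (ar n) g' \<le> val n x d + (1/2)^m * (\<Sum>j\<in>{1..I}. lam j * R i j) + K i * ((1/2)^m)\<^sup>2"
              by blast
            show "val n (X i ((1/2)^m)) d
                \<le> val n x d + (1/2)^m * (\<Sum>j\<in>{1..I}. lam j * R i j) + K i * ((1/2)^m)\<^sup>2"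
              by (rule order_trans[OF val_le[OF n ndX[rule_format, OF i] g'] le])
          qed
        qed
        have Rsum: "(\<Sum>i\<in>{1..I}. R i j) = loc y n j - loc x n j" if "j \<in> {1..I}" for j
        proof -
          have "(\<Sum>i\<in>{1..I}. R i j) = (\<Sum>i\<in>{1..I}. if i = j then R j j else 0)"
            by (rule sum.cong) (auto simp: R_def qloc_def)
          also have "\<dots> = R j j" using that by simp
          finally show ?thesis by (auto simp: R_def qloc_def)
        qed
        \<comment> \<open>Differentiability enters here: one \<open>lam\<close> bounds the quotients
          in all coordinate directions from above, so the bounds add up, and the same
          \<open>lam\<close> is a subgradient.\<close>
        have "(\<Sum>i\<in>{1..I}. \<Sum>j\<in>{1..I}. lam j * R i j) = (\<Sum>j\<in>{1..I}. lam j * (loc y n j - loc x n j))"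
          by (subst sum.swap, intro sum.cong refl) (simp only: sum_distrib_left[symmetric] Rsum)
        also have "\<dots> \<le> val n y d - val n x d"
          using lower[of "gstar (ar n) I (loc y n) d" "loc y n"] gstar_opt[OF n elim(2)]
          by (simp add: val_def is_opt_def)
        finally have tot: "(\<Sum>i\<in>{1..I}. \<Sum>j\<in>{1..I}. lam j * R i j) \<le> val n y d - val n x d" .
        show ?case
        proof (intro exI[of _ "\<lambda>m. val n x d - val n y d - (\<Sum>i\<in>{1..I}. K i) * (1/2)^m"] conjI)
          have "(\<lambda>m. val n x d - val n y d - (\<Sum>i\<in>{1..I}. K i) * (1/2)^m) \<longlonglongrightarrow> val n x d - val n y d - (\<Sum>i\<in>{1..I}. K i) * 0"
            by (intro tendsto_intros LIMSEQ_realpow_zero) auto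
          then show "(\<lambda>m. val n x d - val n y d - (\<Sum>i\<in>{1..I}. K i) * (1/2)^m) \<longlonglongrightarrow> val n x d - val n y d" by simp
          show "\<forall>\<^sub>F m in sequentially. val n x d - val n y d - (\<Sum>i\<in>{1..I}. K i) * (1/2)^m \<le> - D n m d"
            using ev
          proof eventually_elim
            case (elim m)
            have "2 ^ m * (val n (X i ((1/2)^m)) d - val n x d) \<le> (\<Sum>j\<in>{1..I}. lam j * R i j) + K i * (1/2)^m"
              if i: "i \<in> {1..I}" for i
            proof -
              have "2 ^ m * (val n (X i ((1/2)^m)) d - val n x d)
                 \<le> 2 ^ m * ((1/2)^m * (\<Sum>j\<in>{1..I}. lam j * R i j) + K i * ((1/2)^m)\<^sup>2)"
                using elim[rule_format, OF i] by (intro mult_left_mono) (linarith, simp)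
              also have "\<dots> = (\<Sum>j\<in>{1..I}. lam j * R i j) + K i * (1/2)^m"
                by (rule rescale[OF scale])
              finally show ?thesis .
            qed
            then have "D n m d \<le> (\<Sum>i\<in>{1..I}. (\<Sum>j\<in>{1..I}. lam j * R i j) + K i * (1/2)^m)"
              unfolding D_def by (intro sum_mono) auto
            also have "\<dots> \<le> val n y d - val n x d + (\<Sum>i\<in>{1..I}. K i) * (1/2)^m"
              using tot by (simp only: sum.distrib sum_distrib_right add_right_mono)
            finally show ?case by simp
          qed
        qed
      qed
    qed
  qed
  then obtain Z where Z: "\<And>n. n \<in> {1..N} \<Longrightarrow> Z n \<longlonglongrightarrow> integral\<^sup>L (F n) (\<lambda>d. val n x d - val n y d)"
    and Zle: "\<And>n m. n \<in> {1..N} \<Longrightarrow> Z n m \<le> integral\<^sup>L (F n) (\<lambda>d. - D n m d)"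
    by metis
  have "(\<lambda>m. \<Sum>n\<in>{1..N}. Z n m) \<longlonglongrightarrow> (\<Sum>n\<in>{1..N}. integral\<^sup>L (F n) (\<lambda>d. val n x d - val n y d))"
    by (intro tendsto_sum Z)
  also have "(\<Sum>n\<in>{1..N}. integral\<^sup>L (F n) (\<lambda>d. val n x d - val n y d)) = f x - f y"
    unfolding f_eq sum_subtractf[symmetric] using val_integrable x y by (intro sum.cong) auto
  finally have conv: "(\<lambda>m. \<Sum>n\<in>{1..N}. Z n m) \<longlonglongrightarrow> f x - f y" .
  \<comment> \<open>Summed over the areas, the expected quotients are quotients of \<open>f\<close>
    along single coordinates, nonnegative by the assumed minimality.\<close>
  have "(\<Sum>n\<in>{1..N}. Z n m) \<le> 0" for m
  proof -
    have "integral\<^sup>L (F n) (D n m) = (\<Sum>i\<in>{1..I}. 2 ^ m *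
        (integral\<^sup>L (F n) (val n (X i ((1/2) ^ m))) - integral\<^sup>L (F n) (val n x)))" if n: "n \<in> {1..N}" for n
      unfolding D_def[abs_def] using val_integrable[OF n] x Xbox h01
      by (subst Bochner_Integration.integral_sum) auto
    then have "(\<Sum>n\<in>{1..N}. integral\<^sup>L (F n) (D n m))
        = (\<Sum>i\<in>{1..I}. 2 ^ m * (f (X i ((1/2) ^ m)) - f x))"
      unfolding f_eq sum_subtractf[symmetric] sum_distrib_left
      by (subst sum.swap) simp
    moreover have "\<dots> \<ge> 0" using fX h01 by (intro sum_nonneg) simp
    moreover have "(\<Sum>n\<in>{1..N}. Z n m) \<le> - (\<Sum>n\<in>{1..N}. integral\<^sup>L (F n) (D n m))"
      unfolding sum_negf[symmetric] using Zle by (intro sum_mono) simp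
    ultimately show ?thesis by linarith
  qed
  then have "f x - f y \<le> 0" using conv by (intro LIMSEQ_le_const2) auto
  then show ?thesis by simp
qed

section \<open>Continuity of the expected cost up to the caps\<close>

lemma exists_coercivity_constants:
  "\<exists>c. \<forall>n\<in>{1..N}. 0 \<le> c n \<and> (\<forall>g. \<bar>\<Sum>k<nbus (ar n). g k\<bar> - c n \<le> gcost (ar n) g)"
  by (rule bchoice) (use gcost_coercive[OF pd] in auto)

text \<open>A Fatou argument: the subgradient at \<open>x\<close> gives affine minorants of
  \<open>val n (X k) d\<close> converging to \<open>val n x d\<close>, and coercivity gives the
  common bound \<open>- c n\<close>.\<close>

lemma f_lower_limit:
  assumes X: "\<forall>k. X k \<in> capped I Q" and x: "x \<in> capped I Q" and lim: "\<forall>i\<in>{1..I}. (\<lambda>k. X k i) \<longlonglongrightarrow> x i"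
  shows "\<exists>Z. Z \<longlonglongrightarrow> f x \<and> (\<forall>k. Z k \<le> f (X k))"
proof -
  obtain c where c: "\<And>n. n \<in> {1..N} \<Longrightarrow> 0 \<le> c n"
    "\<And>n g. n \<in> {1..N} \<Longrightarrow> \<bar>\<Sum>k<nbus (ar n). g k\<bar> - c n \<le> gcost (ar n) g"
    using exists_coercivity_constants by blast
  have "\<forall>n\<in>{1..N}. \<exists>Z. Z \<longlonglongrightarrow> integral\<^sup>L (F n) (val n x) \<and> (\<forall>k. Z k \<le> integral\<^sup>L (F n) (val n (X k)))"
  proof
    fix n assume n: "n \<in> {1..N}"
    interpret prob_space "F n" by (rule F_prob[OF n])
    show "\<exists>Z. Z \<longlonglongrightarrow> integral\<^sup>L (F n) (val n x) \<and> (\<forall>k. Z k \<le> integral\<^sup>L (F n) (val n (X k)))"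
    proof (rule integral_lower_limit)
      show "integrable (F n) (val n (X k))" for k using val_integrable[OF n] X by blast
      show "integrable (F n) (val n x)" by (rule val_integrable[OF n x])
      show "integrable (F n) (\<lambda>_. - c n)" by simp
      have "- c n \<le> val n q d" for q d
        using c(2)[OF n, of "gstar (ar n) I (loc q n) d"] unfolding val_def by linarith
      then show "AE d in F n. - c n \<le> val n (X k) d" for k by simp
      have "AE d in F n. \<forall>k. nondegenerate (ar n) I (loc (X k) n) d"
        unfolding AE_all_countable using X by (intro allI nondeg n) auto
      with nondeg[OF n x]
      show "AE d in F n. \<exists>Z. Z \<longlonglongrightarrow> val n x d \<and> (\<forall>\<^sub>F k in sequentially. Z k \<le> val n (X k) d)"
      proof eventually_elim
        case (elim d)
        obtain lam where lower: "\<And>qn' g'. g' \<in> feas (ar n) I qn' d \<Longrightarrow>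
             val n x d + (\<Sum>j\<in>{1..I}. lam j * (qn' j - loc x n j)) \<le> gcost (ar n) g'"
          using nondegenerate_first_order[OF pd[OF n] elim(1)] unfolding val_def by blast
        have "val n x d + (\<Sum>j\<in>{1..I}. lam j * (loc (X k) n j - loc x n j)) \<le> val n (X k) d" for k
          using lower[of "gstar (ar n) I (loc (X k) n) d" "loc (X k) n"] gstar_opt[OF n elim(2)[rule_format]]
          by (simp add: val_def is_opt_def)
        moreover have "(\<lambda>k. val n x d + (\<Sum>j\<in>{1..I}. lam j * (loc (X k) n j - loc x n j)))
            \<longlonglongrightarrow> val n x d + (\<Sum>j\<in>{1..I}. lam j * (loc x n j - loc x n j))"
          using lim by (intro tendsto_intros) (auto simp: qloc_def intro!: tendsto_intros)
        ultimately show ?case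
          by (intro exI[of _ "\<lambda>k. val n x d + (\<Sum>j\<in>{1..I}. lam j * (loc (X k) n j - loc x n j))"]) simp
      qed
    qed
  qed
  then obtain Z where Z: "\<And>n. n \<in> {1..N} \<Longrightarrow> Z n \<longlonglongrightarrow> integral\<^sup>L (F n) (val n x)"
    "\<And>n k. n \<in> {1..N} \<Longrightarrow> Z n k \<le> integral\<^sup>L (F n) (val n (X k))" by metis
  show ?thesis
    unfolding f_eq by (intro exI[of _ "\<lambda>k. \<Sum>n\<in>{1..N}. Z n k"] conjI tendsto_sum allI sum_mono Z)
qed

lemma f_upper_coordinate:
  assumes x: "x \<in> capped I Q" and i: "i \<in> {1..I}"
  shows "\<exists>K\<ge>0. \<exists>c>0. \<forall>s. \<bar>s\<bar> \<le> c \<longrightarrow> (x i = Q i \<longrightarrow> s \<le> 0) \<longrightarrow>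
      x(i := x i + s) \<in> capped I Q \<and> f (x(i := x i + s)) \<le> f x + K * \<bar>s\<bar>"
proof -
  \<comment> \<open>Below the cap, \<open>x i + c\<close> is the cap itself. At the cap only
    downward moves occur, and any positive radius would serve.\<close>
  define c where "c = (if x i < Q i then Q i - x i else 1)"
  have c: "c > 0" by (simp add: c_def)
  \<comment> \<open>The absolute slopes to both endpoints. At the cap the upper endpoint leaves the
    capped set, but then it merely adds a nonnegative term.\<close>
  define K where "K = (\<bar>f (x(i := x i + c)) - f x\<bar> + \<bar>f (x(i := x i - c)) - f x\<bar>) / c"
  have "x(i := x i + s) \<in> capped I Q \<and> f (x(i := x i + s)) \<le> f x + K * \<bar>s\<bar>"
    if s: "\<bar>s\<bar> \<le> c" "x i = Q i \<longrightarrow> s \<le> 0" for s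
  proof
    have xi: "x i \<le> Q i" using x i by (simp add: capped_def)
    then show "x(i := x i + s) \<in> capped I Q" using x s by (auto simp: capped_def c_def split: if_splits)
    define e where "e = (if s \<le> 0 then x i - c else x i + c)"
    have ebox: "x(i := e) \<in> capped I Q"
      using x xi c s by (auto simp: capped_def e_def c_def split: if_splits)
    have t: "0 \<le> \<bar>s\<bar> / c" "\<bar>s\<bar> / c \<le> 1" using s c by auto
    have "x(i := x i + s) = (\<lambda>j. (1 - \<bar>s\<bar> / c) * x j + \<bar>s\<bar> / c * (x(i := e)) j)"
      using c by (auto simp: fun_eq_iff e_def field_simps)
    then have "f (x(i := x i + s)) \<le> (1 - \<bar>s\<bar> / c) * f x + \<bar>s\<bar> / c * f (x(i := e))"
      using f_convex[OF x ebox t] by simp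
    also have "\<dots> = f x + (f (x(i := e)) - f x) / c * \<bar>s\<bar>" by (simp add: algebra_simps diff_divide_distrib)
    also have "\<dots> \<le> f x + K * \<bar>s\<bar>"
      unfolding K_def using c by (intro add_left_mono mult_right_mono divide_right_mono) (auto simp: e_def)
    finally show "f (x(i := x i + s)) \<le> f x + K * \<bar>s\<bar>" .
  qed
  moreover have "K \<ge> 0" using c by (simp add: K_def)
  ultimately show ?thesis using c by blast
qed

text \<open>Moving the coordinates in \<open>insert i S\<close> reaches the midpoint of two points:
  one with those in \<open>S\<close> moved twice as far, one with \<open>i\<close> moved twice as
  far. Convexity then combines the two bounds, and the radius is halved.\<close>

lemma f_upper_local:
  assumes x: "x \<in> capped I Q" and S: "finite S" "S \<subseteq> {1..I}"
  shows "\<exists>K\<ge>0. \<exists>c>0. \<forall>r. (\<forall>i\<in>S. \<bar>r i\<bar> \<le> c \<and> (x i = Q i \<longrightarrow> r i \<le> 0)) \<longrightarrow>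
      (\<lambda>i. if i \<in> S then x i + r i else x i) \<in> capped I Q \<and>
      f (\<lambda>i. if i \<in> S then x i + r i else x i) \<le> f x + K * (\<Sum>i\<in>S. \<bar>r i\<bar>)"
  using S
proof (induction S rule: finite_induct)
  case empty
  show ?case using x by (intro exI[of _ 0] conjI exI[of _ 1]) auto
next
  case (insert i S)
  have "S \<subseteq> {1..I}" using insert.prems by simp
  from insert.IH[OF this] obtain K c where K: "K \<ge> 0" "c > 0" and Kc: "\<And>r. (\<forall>i\<in>S. \<bar>r i\<bar> \<le> c \<and> (x i = Q i \<longrightarrow> r i \<le> 0)) \<Longrightarrow>
      (\<lambda>i. if i \<in> S then x i + r i else x i) \<in> capped I Q \<and>
      f (\<lambda>i. if i \<in> S then x i + r i else x i) \<le> f x + K * (\<Sum>i\<in>S. \<bar>r i\<bar>)" by blast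
  obtain K' c' where K': "K' \<ge> 0" "c' > 0" and Kc': "\<And>s. \<bar>s\<bar> \<le> c' \<Longrightarrow> (x i = Q i \<longrightarrow> s \<le> 0) \<Longrightarrow>
      x(i := x i + s) \<in> capped I Q \<and> f (x(i := x i + s)) \<le> f x + K' * \<bar>s\<bar>"
    using f_upper_coordinate[OF x, of i] insert.prems by auto
  show ?case
  proof (rule exI[of _ "K + K'"], intro conjI exI[of _ "min c c' / 2"] allI impI)
    show "0 \<le> K + K'" "0 < min c c' / 2" using K K' by auto
    fix r assume r: "\<forall>j\<in>insert i S. \<bar>r j\<bar> \<le> min c c' / 2 \<and> (x j = Q j \<longrightarrow> r j \<le> 0)"
    define u where "u = (\<lambda>j. if j \<in> S then x j + 2 * r j else x j)"
    define w where "w = x(i := x i + 2 * r i)"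
    have ru: "\<forall>j\<in>S. \<bar>2 * r j\<bar> \<le> c \<and> (x j = Q j \<longrightarrow> 2 * r j \<le> 0)"
      and rw: "\<bar>2 * r i\<bar> \<le> c'" "x i = Q i \<longrightarrow> 2 * r i \<le> 0"
      using r by (auto simp: abs_mult)
    have u: "u \<in> capped I Q" "f u \<le> f x + K * (\<Sum>j\<in>S. \<bar>2 * r j\<bar>)"
      using Kc[of "\<lambda>j. 2 * r j", OF ru] unfolding u_def by blast+
    have w: "w \<in> capped I Q" "f w \<le> f x + K' * \<bar>2 * r i\<bar>"
      using Kc'[of "2 * r i", OF rw] unfolding w_def by blast+
    have e: "(\<lambda>j. if j \<in> insert i S then x j + r j else x j) = (\<lambda>j. (1 - 1/2) * u j + 1/2 * w j)"
      using insert.hyps by (auto simp: fun_eq_iff u_def w_def field_simps)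
    show "(\<lambda>j. if j \<in> insert i S then x j + r j else x j) \<in> capped I Q"
      unfolding e by (intro capped_combine u w) auto
    have "f (\<lambda>j. (1 - 1/2) * u j + 1/2 * w j) \<le> (1 - 1/2) * f u + 1/2 * f w"
      by (intro f_convex u w) auto
    also have "\<dots> \<le> f x + K * (\<Sum>j\<in>S. \<bar>r j\<bar>) + K' * \<bar>r i\<bar>"
    proof -
      have "(\<Sum>j\<in>S. \<bar>2 * r j\<bar>) = 2 * (\<Sum>j\<in>S. \<bar>r j\<bar>)" "\<bar>2 * r i\<bar> = 2 * \<bar>r i\<bar>"
        by (simp_all add: abs_mult sum_distrib_left)
      with u(2) w(2) show ?thesis by (simp add: mult.left_commute[of _ 2])
    qed
    also have "\<dots> \<le> f x + (K + K') * (\<Sum>j\<in>insert i S. \<bar>r j\<bar>)"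
    proof -
      have "0 \<le> K * \<bar>r i\<bar>" "0 \<le> K' * (\<Sum>j\<in>S. \<bar>r j\<bar>)"
        using K K' by (auto intro!: mult_nonneg_nonneg sum_nonneg)
      then show ?thesis using insert.hyps by (simp add: algebra_simps)
    qed
    finally show "f (\<lambda>j. if j \<in> insert i S then x j + r j else x j) \<le> f x + (K + K') * (\<Sum>j\<in>insert i S. \<bar>r j\<bar>)"
      unfolding e .
  qed
qed

text \<open>A convex function may jump up at a binding cap. Convexity gives the upper bound; the
  lower one comes from the subgradients of \<open>val\<close>.\<close>

lemma f_continuous:
  assumes X: "\<forall>k. X k \<in> capped I Q" and lim: "\<forall>i\<in>{1..I}. (\<lambda>k. X k i) \<longlonglongrightarrow> x i"
  shows "(\<lambda>k. f (X k)) \<longlonglongrightarrow> f x"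
proof -
  have x: "x \<in> capped I Q" unfolding capped_def
  proof (intro CollectI ballI)
    fix i assume i: "i \<in> {1..I}"
    show "x i \<le> Q i"
      by (rule LIMSEQ_le_const2[of "\<lambda>k. X k i"]) (use X lim i in \<open>auto simp: capped_def\<close>)
  qed
  obtain Z where Z: "Z \<longlonglongrightarrow> f x" "\<And>k. Z k \<le> f (X k)" using f_lower_limit[OF X x lim] by blast
  obtain K c where c: "c > 0" and Kc: "\<And>r. (\<forall>i\<in>{1..I}. \<bar>r i\<bar> \<le> c \<and> (x i = Q i \<longrightarrow> r i \<le> 0)) \<Longrightarrow>
      f (\<lambda>i. if i \<in> {1..I} then x i + r i else x i) \<le> f x + K * (\<Sum>i\<in>{1..I}. \<bar>r i\<bar>)"
    using f_upper_local[OF x, of "{1..I}"] by auto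
  have "\<forall>\<^sub>F k in sequentially. \<forall>i\<in>{1..I}. \<bar>X k i - x i\<bar> < c"
  proof (intro eventually_ball_finite ballI)
    fix i assume "i \<in> {1..I}"
    then show "\<forall>\<^sub>F k in sequentially. \<bar>X k i - x i\<bar> < c"
      using tendstoD[OF lim[rule_format] c] by (simp add: dist_real_def)
  qed simp
  then have upper: "\<forall>\<^sub>F k in sequentially. f (X k) \<le> f x + K * (\<Sum>i\<in>{1..I}. \<bar>X k i - x i\<bar>)"
  proof eventually_elim
    case (elim k)
    have "f (X k) = f (\<lambda>i. if i \<in> {1..I} then x i + (X k i - x i) else x i)" by (rule f_cong) simp
    also have "\<dots> \<le> f x + K * (\<Sum>i\<in>{1..I}. \<bar>X k i - x i\<bar>)"
      using X elim by (intro Kc) (auto simp: capped_def intro: less_imp_le)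
    finally show ?case .
  qed
  have "(\<lambda>k. f x + K * (\<Sum>i\<in>{1..I}. \<bar>X k i - x i\<bar>)) \<longlonglongrightarrow> f x + K * (\<Sum>i\<in>{1..I}. \<bar>x i - x i\<bar>)"
    using lim by (intro tendsto_intros) auto
  then have U: "(\<lambda>k. f x + K * (\<Sum>i\<in>{1..I}. \<bar>X k i - x i\<bar>)) \<longlonglongrightarrow> f x" by simp
  show ?thesis
    by (rule tendsto_sandwich[OF _ upper Z(1) U]) (use Z(2) in simp)
qed

text \<open>Generation balances the interchange, so the cost of an area grows at least linearly in its net
  export. A single step changes the net export of the origin of the interface by the step length;
  hence steps inside a sublevel set are bounded, although the sublevel set need not be.\<close>

lemma f_step_bounded:
  "\<exists>R. \<forall>x\<in>capped I Q. \<forall>i\<in>{1..I}. \<forall>y. x(i := y) \<in> capped I Q \<longrightarrow>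
     f x \<le> l \<longrightarrow> f (x(i := y)) \<le> l \<longrightarrow> \<bar>y - x i\<bar> \<le> R"
proof -
  obtain c where c: "\<And>n. n \<in> {1..N} \<Longrightarrow> 0 \<le> c n"
    "\<And>n g. n \<in> {1..N} \<Longrightarrow> \<bar>\<Sum>k<nbus (ar n). g k\<bar> - c n \<le> gcost (ar n) g"
    using exists_coercivity_constants by blast
  define s where "s = (\<Sum>n\<in>{1..N}. c n)"
  have valc: "- c n \<le> val n q d" if n: "n \<in> {1..N}" for n q d
    using c(2)[OF n, of "gstar (ar n) I (loc q n) d"] unfolding val_def by linarith
  have Ec: "- c n \<le> integral\<^sup>L (F n) (val n q)" if n: "n \<in> {1..N}" and q: "q \<in> capped I Q" for n q
  proof -
    interpret prob_space "F n" by (rule F_prob[OF n])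
    show ?thesis by (intro integral_ge_const val_integrable n q AE_I2 valc)
  qed
  \<comment> \<open>One area cannot cost much more than the level \<open>l\<close>, because the
    costs of the others are bounded below.\<close>
  have El: "integral\<^sup>L (F n) (val n q) \<le> l + s" if n: "n \<in> {1..N}" and q: "q \<in> capped I Q" "f q \<le> l" for n q
  proof -
    have "integral\<^sup>L (F n) (val n q) + c n \<le> (\<Sum>n\<in>{1..N}. integral\<^sup>L (F n) (val n q) + c n)"
      using Ec[OF _ q(1)] n by (intro member_le_sum) fastforce+
    also have "\<dots> = f q + s" by (simp add: f_eq s_def sum.distrib)
    finally show ?thesis using q c(1)[OF n] by linarith
  qed
  have cs: "c n \<le> s" if "n \<in> {1..N}" for n unfolding s_def by (intro member_le_sum c that) auto
  \<comment> \<open>Two expected costs of the origin area contribute \<open>l + s\<close> each, and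
    two coercivity constants at most \<open>s\<close> each.\<close>
  have "\<bar>y - x i\<bar> \<le> 2 * (l + s) + 2 * s"
    if x: "x \<in> capped I Q" and i: "i \<in> {1..I}" and y: "x(i := y) \<in> capped I Q" and l: "f x \<le> l" "f (x(i := y)) \<le> l" for x i y
  proof -
    define n where "n = orig i"
    have n: "n \<in> {1..N}" using interfaces[OF i] by (simp add: n_def)
    interpret prob_space "F n" by (rule F_prob[OF n])
    have "(\<Sum>j\<in>{1..I}. loc (x(i := y)) n j) - (\<Sum>j\<in>{1..I}. loc x n j) = (\<Sum>j\<in>{1..I}. if j = i then y - x i else 0)"
      unfolding sum_subtractf[symmetric] by (rule sum.cong) (auto simp: qloc_def n_def)
    then have diff: "(\<Sum>j\<in>{1..I}. loc (x(i := y)) n j) - (\<Sum>j\<in>{1..I}. loc x n j) = y - x i"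
      using i by simp
    have "AE d in F n. \<bar>y - x i\<bar> - 2 * c n \<le> val n x d + val n (x(i := y)) d"
      using nondeg[OF n x] nondeg[OF n y]
    proof eventually_elim
      case (elim d)
      have bal: "(\<Sum>k<nbus (ar n). gstar (ar n) I (loc q n) d k) = (\<Sum>k<nbus (ar n). d k) + (\<Sum>j\<in>{1..I}. loc q n j)"
        if "nondegenerate (ar n) I (loc q n) d" for q
        using gstar_opt[OF n that] by (auto simp: is_opt_def feas_def sum_subtractf)
      \<comment> \<open>\<open>D\<close> is the total load and \<open>L\<close>, \<open>L'\<close>
        are the net exports before and after the step; the load cancels in the difference of the
        total generations.\<close>
      have arith: "\<bar>e\<bar> - 2 * b \<le> v + v'" if "\<bar>G\<bar> - b \<le> v" "\<bar>G'\<bar> - b \<le> v'" "G = D + L" "G' = D + L'" "L' - L = e"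
        for e b v v' G G' D L L' :: real using that by linarith
      show ?case
        unfolding val_def by (rule arith[OF c(2)[OF n] c(2)[OF n] bal[OF elim(1)] bal[OF elim(2)] diff])
    qed
    then have "\<bar>y - x i\<bar> - 2 * c n \<le> integral\<^sup>L (F n) (\<lambda>d. val n x d + val n (x(i := y)) d)"
      by (intro integral_ge_const Bochner_Integration.integrable_add val_integrable n x y)
    also have "\<dots> = integral\<^sup>L (F n) (val n x) + integral\<^sup>L (F n) (val n (x(i := y)))"
      by (intro Bochner_Integration.integral_add val_integrable n x y)
    finally show ?thesis
      using El[OF n x l(1)] El[OF n y l(2)] cs[OF n] by argo
  qed
  then show ?thesis by blast
qed

end

section \<open>Optimality of limit points for the sampled updates\<close>

theorem theorem3:
  fixes N I :: nat
    and orig dest :: "nat \<Rightarrow> nat"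
    and Q :: "nat \<Rightarrow> real"
    and ar :: "nat \<Rightarrow> area_data"
    and F :: "nat \<Rightarrow> (nat \<Rightarrow> real) measure"
    and M :: "'w measure"
    and D :: "nat \<Rightarrow> nat \<Rightarrow> 'w \<Rightarrow> (nat \<Rightarrow> real)"
    and qs :: "nat \<Rightarrow> nat \<Rightarrow> real"
    and qt :: "nat \<Rightarrow> real"
  assumes interfaces: "\<forall>i\<in>{1..I}. orig i \<in> {1..N} \<and> dest i \<in> {1..N} \<and> orig i \<noteq> dest i"
    and H_posdef: "\<forall>n\<in>{1..N}.
        (\<forall>j<nbus (ar n). \<forall>k<nbus (ar n). Hm (ar n) j k = Hm (ar n) k j)
        \<and> (\<forall>v::nat\<Rightarrow>real. (\<exists>k<nbus (ar n). v k \<noteq> 0) \<longrightarrow>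
              (\<Sum>j<nbus (ar n). \<Sum>k<nbus (ar n). v j * Hm (ar n) j k * v k) > 0)"
    and F_prob: "\<forall>n\<in>{1..N}. prob_space (F n) \<and> sets (F n) = sets borel"
    and feas_nondeg: "\<forall>n\<in>{1..N}. \<forall>q. (\<forall>i\<in>{1..I}. q i \<le> Q i) \<longrightarrow>
        (AE d in F n. feas (ar n) I (qloc I orig dest q n) d \<noteq> {}
                      \<and> nondegenerate (ar n) I (qloc I orig dest q n) d)"
    and Cbar_finite: "\<forall>n\<in>{1..N}. \<forall>q. (\<forall>i\<in>{1..I}. q i \<le> Q i) \<longrightarrow>
        integrable (F n) (\<lambda>d. gcost (ar n) (gstar (ar n) I (qloc I orig dest q n) d))"
    and M_prob: "prob_space M"
    and iid: "\<forall>n\<in>{1..N}. prob_space.indep_vars M (\<lambda>_. borel) (D n) {1..}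
        \<and> (\<forall>t\<ge>1. distr M borel (D n t) = F n)"
    and init: "\<forall>i\<in>{1..I}. qs 0 i \<le> Q i"
    and update: "\<forall>t\<ge>1.
        (\<forall>j\<in>{1..I}. j \<noteq> (t - 1) mod I + 1 \<longrightarrow> qs t j = qs (t - 1) j)
        \<and> qs t ((t - 1) mod I + 1) \<le> Q ((t - 1) mod I + 1)
        \<and> (\<forall>x. x \<le> Q ((t - 1) mod I + 1) \<longrightarrow>
             (\<Sum>n\<in>{1..N}. integral\<^sup>L M (\<lambda>w. gcost (ar n) (gstar (ar n) I
                 (qloc I orig dest ((qs (t - 1))((t - 1) mod I + 1 := qs t ((t - 1) mod I + 1))) n)
                 (D n t w))))
             \<le> (\<Sum>n\<in>{1..N}. integral\<^sup>L M (\<lambda>w. gcost (ar n) (gstar (ar n) I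
                 (qloc I orig dest ((qs (t - 1))((t - 1) mod I + 1 := x)) n)
                 (D n t w)))))"
    and limit_point: "\<exists>\<sigma>::nat\<Rightarrow>nat. strict_mono \<sigma> \<and>
        (\<forall>i\<in>{1..I}. (\<lambda>k. qs (\<sigma> k) i) \<longlonglongrightarrow> qt i)"
  shows "(\<forall>i\<in>{1..I}. qt i \<le> Q i) \<and>
         (\<forall>q. (\<forall>i\<in>{1..I}. q i \<le> Q i) \<longrightarrow> Cbar N I orig dest ar F qt \<le> Cbar N I orig dest ar F q)"
proof -
  have pd: "posdef (ar n)" if "n \<in> {1..N}" for n
    using H_posdef that unfolding posdef_def quad_form_def by blast
  interpret interchange N I orig dest Q ar F
  proof (rule interchange.intro)
    fix i assume "i \<in> {1..I}"
    then show "orig i \<in> {1..N} \<and> dest i \<in> {1..N} \<and> orig i \<noteq> dest i" using interfaces by blast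
  next
    fix n assume n: "n \<in> {1..N}"
    show "posdef (ar n)" by (rule pd[OF n])
    show "prob_space (F n)" using F_prob n by blast
    fix q assume "q \<in> capped I Q"
    then have q: "\<forall>i\<in>{1..I}. q i \<le> Q i" by (simp add: capped_def)
    from feas_nondeg[rule_format, OF n] q
    have "AE d in F n. feas (ar n) I (qloc I orig dest q n) d \<noteq> {} \<and> nondegenerate (ar n) I (qloc I orig dest q n) d"
      by blast
    then show "AE d in F n. nondegenerate (ar n) I (qloc I orig dest q n) d"
      by eventually_elim blast
    show "integrable (F n) (\<lambda>d. gcost (ar n) (gstar (ar n) I (qloc I orig dest q n) d))"
      using Cbar_finite n q by blast
  qed
  obtain \<sigma> :: "nat \<Rightarrow> nat" where \<sigma>: "strict_mono \<sigma>"
    and lim: "\<forall>i\<in>{1..I}. (\<lambda>k. qs (\<sigma> k) i) \<longlonglongrightarrow> qt i" using limit_point by blast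
  have feasible: "qs t \<in> capped I Q" for t
  proof (induction t)
    case 0
    then show ?case using init by (simp add: capped_def)
  next
    case (Suc t)
    have "qs (Suc t) i \<le> Q i" if "i \<in> {1..I}" for i
      using update[rule_format, of "Suc t"] Suc that by (cases "i = t mod I + 1") (auto simp: capped_def)
    then show ?case by (simp add: capped_def)
  qed
  have "qt i \<le> Q i" if i: "i \<in> {1..I}" for i
    by (rule LIMSEQ_le_const2[of "\<lambda>k. qs (\<sigma> k) i"]) (use lim i feasible in \<open>auto simp: capped_def\<close>)
  moreover have "f qt \<le> f q" if q: "\<forall>i\<in>{1..I}. q i \<le> Q i" for q
  \<comment> \<open>Without interfaces \<open>f\<close> is constant, whereas the cyclic argument
    needs a positive period.\<close>
  proof (cases "I = 0")
    case True
    then have "f qt = f q" by (intro f_cong) simp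
    then show ?thesis by simp
  next
    case False
    \<comment> \<open>Each load \<open>D n t\<close> has distribution \<open>F n\<close>, so the
      objective of every update is \<open>f\<close> itself and the scheme is exact coordinate
      descent for a deterministic function.\<close>
    have sample: "(\<Sum>n\<in>{1..N}. integral\<^sup>L M (\<lambda>w. gcost (ar n) (gstar (ar n) I (loc x n) (D n t w)))) = f x"
      if x: "x \<in> capped I Q" and t: "1 \<le> t" for x t
      unfolding f_eq
    proof (rule sum.cong[OF refl])
      fix n assume n: "n \<in> {1..N}"
      have "D n t \<in> measurable M borel" and distr: "distr M borel (D n t) = F n"
        using iid[rule_format, OF n] t unfolding prob_space.indep_vars_def[OF M_prob] by auto
      \<comment> \<open>Integrability under \<open>F n\<close>, a distribution on
        \<open>borel\<close>, provides the Borel measurability needed for the change of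
        variables.\<close>
      moreover have "val n x \<in> borel_measurable borel"
        using borel_measurable_integrable[OF val_integrable[OF n x]]
        unfolding distr[symmetric] by simp
      ultimately show "integral\<^sup>L M (\<lambda>w. gcost (ar n) (gstar (ar n) I (loc x n) (D n t w))) = integral\<^sup>L (F n) (val n x)"
        unfolding distr[symmetric] by (subst integral_distr) (auto simp: val_def)
    qed
    show ?thesis
    proof (rule cyclic_descent_limit_point_minimizes[OF _ f_cong f_continuous f_coordinatewise_min
          f_step_bounded feasible _ _ \<sigma> lim])
      show "0 < I" using False by simp
      show "q \<in> capped I Q" using q by (simp add: capped_def)
      show keep: "qs (Suc t) j = qs t j" if "j \<in> {1..I}" "j \<noteq> t mod I + 1" for t j
        using update[rule_format, of "Suc t"] that by simp
      show "f (qs (Suc t)) \<le> f ((qs t)(t mod I + 1 := x))" if x: "x \<le> Q (t mod I + 1)" for t x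
      proof -
        let ?i = "t mod I + 1"
        have new: "qs (Suc t) ?i \<le> Q ?i" using update[rule_format, of "Suc t"] by simp
        have upd: "(qs t)(?i := z) \<in> capped I Q" if "z \<le> Q ?i" for z
          using feasible[of t] that by (auto simp: capped_def)
        have "f (qs (Suc t)) = f ((qs t)(?i := qs (Suc t) ?i))"
          using keep[of _ t] by (intro f_cong) auto
        also have "\<dots> \<le> f ((qs t)(?i := x))"
        proof -
          have "1 \<le> Suc t" by simp
          from update[rule_format, OF this, THEN conjunct2, THEN conjunct2, rule_format] x show ?thesis
            unfolding sample[OF upd[OF new] \<open>1 \<le> Suc t\<close>, symmetric] sample[OF upd[OF x] \<open>1 \<le> Suc t\<close>, symmetric]
            by (simp only: diff_Suc_1)
        qed
        finally show ?thesis .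
      qed
    qed
  qed
  ultimately show ?thesis by blast
qed

end
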